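(* Let $\mathcal{S}$ be a geometric sketch and let $\gimel(\mathcal{S})$ be its classifying topos. If the component at $\gimel(\mathcal{S})$ of the counit of the Scott adjunction, $\epsilon_{\gimel(\mathcal{S})}: \mathsf{S}\,\mathsf{pt}(\gimel(\mathcal{S})) \to \gimel(\mathcal{S})$, is an equivalence of categories, then $\gimel(\mathcal{S})$ is equivalent to the Scott topos $\mathsf{S}(\mathsf{Mod}(\mathcal{S}))$ of the category of $\mathbf{Set}$-models of $\mathcal{S}$.
   Context: Topos means Grothendieck topos; geometric morphisms $f:\mathcal{E}\to\mathcal{F}$ are adjunctions $f^*\dashv f_*$ with $f^*:\mathcal{F}\to\mathcal{E}$ preserving finite limits; $\text{Topoi}$ is the $2$-category of topoi, geometric morphisms, and natural transformations between inverse images $f^*$. $\text{Acc}_\omega$ is the $2$-category of accessible categories having (all) directed colimits, functors preserving directed colimits, and natural transformations. A sketch $\mathcal{S}=(S,L,C,\sigma)$ is a small category $S$, a class $L$ of diagrams in $S$ (limit diagrams), a class $C$ of diagrams in $S$ (colimit diagrams), and a function $\sigma$ assigning a cone to each diagram in $L$ and a cocone to each diagram in $C$. It is geometric if each specified cone is finite. A model of $\mathcal{S}$ in a category $\mathcal{C}$ is a functor $S\to\mathcal{C}$ sending each specified cone (cocone) to a limit cone (colimit cocone); $\mathsf{Mod}_{\mathcal{C}}(\mathcal{S})$ is the full subcategory of $\mathcal{C}^S$ on the models, and $\mathsf{Mod}(\mathcal{S})=\mathsf{Mod}_{\mathbf{Set}}(\mathcal{S})$. $\gimel(\mathcal{S})$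 is the classifying topos of $\mathcal{S}$: the topos, unique up to equivalence, with equivalences $\text{Topoi}(\mathcal{E},\gimel(\mathcal{S}))\simeq\mathsf{Mod}_{\mathcal{E}}(\mathcal{S})$ natural in the topos $\mathcal{E}$. Scott adjunction: for $\mathcal{A}\in\text{Acc}_\omega$, the Scott topos $\mathsf{S}(\mathcal{A})=\text{Acc}_\omega(\mathcal{A},\mathbf{Set})$ is the category of directed-colimit-preserving functors $\mathcal{A}\to\mathbf{Set}$, which is a topos; for a topos $\mathcal{E}$, $\mathsf{pt}(\mathcal{E})=\text{Topoi}(\mathbf{Set},\mathcal{E})$ is its category of points, which is an object of $\text{Acc}_\omega$. There is a biadjunction $\mathsf{S}:\text{Acc}_\omega\leftrightarrows\text{Topoi}:\mathsf{pt}$ with $\mathsf{S}$ left biadjoint. Its counit $\epsilon_{\mathcal{E}}:\mathsf{S}\,\mathsf{pt}(\mathcal{E})\to\mathcal{E}$ is the geometric morphism whose inverse image sends $e\in\mathcal{E}$ to the functor $p\mapsto p^*(e)$ on $\mathsf{pt}(\mathcal{E})$. *)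

theory Defs
  imports Main "HOL-Library.FuncSet" "HOL-Library.Equipollence"
begin

section \<open>The universe\<close>

text \<open>
  Size distinctions are relative to a type \<open>'u\<close> whose cardinality is strongly inaccessible, which
  plays the role of a Grothendieck universe. The small sets are the subsets of \<open>'u\<close> of smaller
  cardinality than \<open>'u\<close>; every set of such a cardinality is in bijection with one of these, so that
  they and all functions between them form (a category equivalent to) the category of sets.
\<close>

definition small :: "'u set \<Rightarrow> bool" where
  "small A \<longleftrightarrow> A \<prec> (UNIV :: 'u set)"

definition universe :: "'u itself \<Rightarrow> bool" where
  "universe _ \<longleftrightarrow>
     (\<exists>A :: 'u set. small A \<and> infinite A) \<and>
     (\<forall>A :: 'u set. small A \<longrightarrow> Pow A \<prec> (UNIV :: 'u set)) \<and>
     (\<forall>(I :: 'u set) (A :: 'u \<Rightarrow> 'u set).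
        small I \<and> (\<forall>i\<in>I. small (A i)) \<longrightarrow> small (\<Union>i\<in>I. A i))"

section \<open>Categories, functors, natural transformations\<close>

record ('o, 'a) category =
  Obj :: "'o set"
  Arr :: "'a set"
  Dom :: "'a \<Rightarrow> 'o"
  Cod :: "'a \<Rightarrow> 'o"
  Ident :: "'o \<Rightarrow> 'a"
  Comp :: "'a \<Rightarrow> 'a \<Rightarrow> 'a"  \<comment> \<open>\<open>Comp C g f\<close> is \<open>g\<close> after \<open>f\<close>\<close>

definition hom :: "('o, 'a) category \<Rightarrow> 'o \<Rightarrow> 'o \<Rightarrow> 'a set" where
  "hom C x y = {f \<in> Arr C. Dom C f = x \<and> Cod C f = y}"

definition is_category :: "('o, 'a) category \<Rightarrow> bool" where
  "is_category C \<longleftrightarrow>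
     (\<forall>f\<in>Arr C. Dom C f \<in> Obj C \<and> Cod C f \<in> Obj C) \<and>
     (\<forall>x\<in>Obj C. Ident C x \<in> hom C x x) \<and>
     (\<forall>f\<in>Arr C. \<forall>g\<in>Arr C. Dom C g = Cod C f \<longrightarrow>
        Comp C g f \<in> hom C (Dom C f) (Cod C g)) \<and>
     (\<forall>f\<in>Arr C. Comp C f (Ident C (Dom C f)) = f \<and> Comp C (Ident C (Cod C f)) f = f) \<and>
     (\<forall>f\<in>Arr C. \<forall>g\<in>Arr C. \<forall>h\<in>Arr C. Dom C g = Cod C f \<and> Dom C h = Cod C g \<longrightarrow>
        Comp C h (Comp C g f) = Comp C (Comp C h g) f)"

definition small_category :: "('u, 'u) category \<Rightarrow> bool" where
  "small_category C \<longleftrightarrow> is_category C \<and> small (Obj C) \<and> small (Arr C)"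

definition finite_category :: "('o, 'a) category \<Rightarrow> bool" where
  "finite_category C \<longleftrightarrow> is_category C \<and> finite (Obj C) \<and> finite (Arr C)"

definition op_category :: "('o, 'a) category \<Rightarrow> ('o, 'a) category" where
  "op_category C = \<lparr>Obj = Obj C, Arr = Arr C, Dom = Cod C, Cod = Dom C, Ident = Ident C,
     Comp = (\<lambda>g f. Comp C f g)\<rparr>"

definition full_subcategory :: "('o, 'a) category \<Rightarrow> ('o \<Rightarrow> bool) \<Rightarrow> ('o, 'a) category" where
  "full_subcategory C P = C\<lparr>Obj := {x \<in> Obj C. P x},
     Arr := {f \<in> Arr C. P (Dom C f) \<and> P (Cod C f)}\<rparr>"

definition is_iso :: "('o, 'a) category \<Rightarrow> 'a \<Rightarrow> bool" where
  "is_iso C f \<longleftrightarrow> f \<in> Arr C \<and> (\<exists>g\<in>hom C (Cod C f) (Dom C f).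
     Comp C g f = Ident C (Dom C f) \<and> Comp C f g = Ident C (Cod C f))"

definition isomorphic :: "('o, 'a) category \<Rightarrow> 'o \<Rightarrow> 'o \<Rightarrow> bool" where
  "isomorphic C x y \<longleftrightarrow> (\<exists>f\<in>hom C x y. is_iso C f)"

text \<open>
  Functors and natural transformations are extensional (\<open>undefined\<close> off their domain), so that
  equality of the representing records is equality of functors.
\<close>

record ('o, 'a, 'p, 'b) func =
  fobj :: "'o \<Rightarrow> 'p"
  farr :: "'a \<Rightarrow> 'b"

definition is_functor ::
    "('o, 'a) category \<Rightarrow> ('p, 'b) category \<Rightarrow> ('o, 'a, 'p, 'b) func \<Rightarrow> bool" where
  "is_functor C D F \<longleftrightarrow> is_category C \<and> is_category D \<and>
     fobj F \<in> Obj C \<rightarrow>\<^sub>E Obj D \<and> farr F \<in> Arr C \<rightarrow>\<^sub>E Arr D \<and>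
     (\<forall>f\<in>Arr C. farr F f \<in> hom D (fobj F (Dom C f)) (fobj F (Cod C f))) \<and>
     (\<forall>x\<in>Obj C. farr F (Ident C x) = Ident D (fobj F x)) \<and>
     (\<forall>f\<in>Arr C. \<forall>g\<in>Arr C. Dom C g = Cod C f \<longrightarrow>
        farr F (Comp C g f) = Comp D (farr F g) (farr F f))"

definition id_functor :: "('o, 'a) category \<Rightarrow> ('o, 'a, 'o, 'a) func" where
  "id_functor C = \<lparr>fobj = (\<lambda>x\<in>Obj C. x), farr = (\<lambda>f\<in>Arr C. f)\<rparr>"

definition comp_functor :: "('o, 'a) category \<Rightarrow> ('p, 'b, 'q, 'c) func \<Rightarrow>
    ('o, 'a, 'p, 'b) func \<Rightarrow> ('o, 'a, 'q, 'c) func" where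
  "comp_functor C G F = \<lparr>fobj = (\<lambda>x\<in>Obj C. fobj G (fobj F x)),
     farr = (\<lambda>f\<in>Arr C. farr G (farr F f))\<rparr>"

definition nat_trans :: "('o, 'a) category \<Rightarrow> ('p, 'b) category \<Rightarrow> ('o, 'a, 'p, 'b) func \<Rightarrow>
    ('o, 'a, 'p, 'b) func \<Rightarrow> ('o \<Rightarrow> 'b) \<Rightarrow> bool" where
  "nat_trans C D F G \<tau> \<longleftrightarrow> is_functor C D F \<and> is_functor C D G \<and> \<tau> \<in> extensional (Obj C) \<and>
     (\<forall>x\<in>Obj C. \<tau> x \<in> hom D (fobj F x) (fobj G x)) \<and>
     (\<forall>f\<in>Arr C. Comp D (\<tau> (Cod C f)) (farr F f) = Comp D (farr G f) (\<tau> (Dom C f)))"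

text \<open>Arrows that remember their source and target.\<close>

datatype ('x, 'f) mor = Mor (src: 'x) (tgt: 'x) (cmp: 'f)

definition functor_category :: "('o, 'a) category \<Rightarrow> ('p, 'b) category \<Rightarrow>
    (('o, 'a, 'p, 'b) func, (('o, 'a, 'p, 'b) func, 'o \<Rightarrow> 'b) mor) category" where
  "functor_category C D = \<lparr>Obj = {F. is_functor C D F},
     Arr = {Mor F G \<tau> | F G \<tau>. nat_trans C D F G \<tau>},
     Dom = src, Cod = tgt,
     Ident = (\<lambda>F. Mor F F (\<lambda>x\<in>Obj C. Ident D (fobj F x))),
     Comp = (\<lambda>\<beta> \<alpha>. Mor (src \<alpha>) (tgt \<beta>) (\<lambda>x\<in>Obj C. Comp D (cmp \<beta> x) (cmp \<alpha> x)))\<rparr>"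

definition equivalence ::
    "('o, 'a) category \<Rightarrow> ('p, 'b) category \<Rightarrow> ('o, 'a, 'p, 'b) func \<Rightarrow> bool" where
  "equivalence C D F \<longleftrightarrow> is_functor C D F \<and> (\<exists>G. is_functor D C G \<and>
     isomorphic (functor_category C C) (comp_functor C G F) (id_functor C) \<and>
     isomorphic (functor_category D D) (comp_functor D F G) (id_functor D))"

definition equivalent :: "('o, 'a) category \<Rightarrow> ('p, 'b) category \<Rightarrow> bool" where
  "equivalent C D \<longleftrightarrow> (\<exists>F. equivalence C D F)"

section \<open>The category of sets\<close>

type_synonym 'u setarr = "('u set, 'u \<Rightarrow> 'u) mor"

definition set_category :: "('u set, 'u setarr) category" where
  "set_category = \<lparr>Obj = {A. small A},
     Arr = {Mor A B f | A B f. small A \<and> small B \<and> f \<in> A \<rightarrow>\<^sub>E B},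
     Dom = src, Cod = tgt,
     Ident = (\<lambda>A. Mor A A (\<lambda>x\<in>A. x)),
     Comp = (\<lambda>g f. Mor (src f) (tgt g) (\<lambda>x\<in>src f. cmp g (cmp f x)))\<rparr>"

section \<open>Limits and colimits\<close>

record ('i, 'o, 'a) cone =
  apex :: 'o
  leg :: "'i \<Rightarrow> 'a"

definition is_cone :: "('i, 'j) category \<Rightarrow> ('o, 'a) category \<Rightarrow> ('i, 'j, 'o, 'a) func \<Rightarrow>
    ('i, 'o, 'a) cone \<Rightarrow> bool" where
  "is_cone I C D c \<longleftrightarrow> is_functor I C D \<and> apex c \<in> Obj C \<and>
     (\<forall>i\<in>Obj I. leg c i \<in> hom C (apex c) (fobj D i)) \<and>
     (\<forall>k\<in>Arr I. Comp C (farr D k) (leg c (Dom I k)) = leg c (Cod I k))"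

definition is_limit_cone :: "('i, 'j) category \<Rightarrow> ('o, 'a) category \<Rightarrow> ('i, 'j, 'o, 'a) func \<Rightarrow>
    ('i, 'o, 'a) cone \<Rightarrow> bool" where
  "is_limit_cone I C D c \<longleftrightarrow> is_cone I C D c \<and>
     (\<forall>c'. is_cone I C D c' \<longrightarrow>
        (\<exists>!u. u \<in> hom C (apex c') (apex c) \<and> (\<forall>i\<in>Obj I. Comp C (leg c i) u = leg c' i)))"

text \<open>Cocones are cones in the opposite category, with the record of the diagram unchanged.\<close>

definition is_cocone :: "('i, 'j) category \<Rightarrow> ('o, 'a) category \<Rightarrow> ('i, 'j, 'o, 'a) func \<Rightarrow>
    ('i, 'o, 'a) cone \<Rightarrow> bool" where
  "is_cocone I C D c \<longleftrightarrow> is_cone (op_category I) (op_category C) D c"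

definition is_colimit_cocone :: "('i, 'j) category \<Rightarrow> ('o, 'a) category \<Rightarrow>
    ('i, 'j, 'o, 'a) func \<Rightarrow> ('i, 'o, 'a) cone \<Rightarrow> bool" where
  "is_colimit_cocone I C D c \<longleftrightarrow> is_limit_cone (op_category I) (op_category C) D c"

definition map_cone ::
    "('o, 'a, 'p, 'b) func \<Rightarrow> ('i, 'o, 'a) cone \<Rightarrow> ('i, 'p, 'b) cone" where
  "map_cone F c = \<lparr>apex = fobj F (apex c), leg = (\<lambda>i. farr F (leg c i))\<rparr>"

text \<open>Every finite category is isomorphic to one whose objects and arrows are natural numbers.\<close>

definition preserves_finite_limits ::
    "('o, 'a) category \<Rightarrow> ('p, 'b) category \<Rightarrow> ('o, 'a, 'p, 'b) func \<Rightarrow> bool" where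
  "preserves_finite_limits C D F \<longleftrightarrow>
     (\<forall>(I :: (nat, nat) category) X c. finite_category I \<and> is_limit_cone I C X c \<longrightarrow>
        is_limit_cone I D (comp_functor I F X) (map_cone F c))"

definition directed_poset :: "'u set \<Rightarrow> ('u \<times> 'u) set \<Rightarrow> bool" where
  "directed_poset P r \<longleftrightarrow> P \<noteq> {} \<and> partial_order_on P r \<and>
     (\<forall>x\<in>P. \<forall>y\<in>P. \<exists>z\<in>P. (x, z) \<in> r \<and> (y, z) \<in> r)"

definition poset_category :: "'u set \<Rightarrow> ('u \<times> 'u) set \<Rightarrow> ('u, 'u \<times> 'u) category" where
  "poset_category P r = \<lparr>Obj = P, Arr = r, Dom = fst, Cod = snd, Ident = (\<lambda>x. (x, x)),
     Comp = (\<lambda>g f. (fst f, snd g))\<rparr>"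

definition preserves_directed_colimits :: "'u itself \<Rightarrow> ('o, 'a) category \<Rightarrow>
    ('p, 'b) category \<Rightarrow> ('o, 'a, 'p, 'b) func \<Rightarrow> bool" where
  "preserves_directed_colimits _ C D F \<longleftrightarrow>
     (\<forall>(P :: 'u set) r X c. small P \<and> directed_poset P r \<and>
        is_colimit_cocone (poset_category P r) C X c \<longrightarrow>
        is_colimit_cocone (poset_category P r) D
          (comp_functor (poset_category P r) F X) (map_cone F c))"

section \<open>Grothendieck topoi\<close>

definition is_sieve :: "('o, 'a) category \<Rightarrow> 'o \<Rightarrow> 'a set \<Rightarrow> bool" where
  "is_sieve C x R \<longleftrightarrow> R \<subseteq> {f \<in> Arr C. Cod C f = x} \<and>
     (\<forall>f\<in>R. \<forall>g\<in>Arr C. Cod C g = Dom C f \<longrightarrow> Comp C f g \<in> R)"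

definition pullback_sieve :: "('o, 'a) category \<Rightarrow> 'a \<Rightarrow> 'a set \<Rightarrow> 'a set" where
  "pullback_sieve C h R = {g \<in> Arr C. Cod C g = Dom C h \<and> Comp C h g \<in> R}"

definition grothendieck_topology :: "('o, 'a) category \<Rightarrow> ('o \<Rightarrow> 'a set set) \<Rightarrow> bool" where
  "grothendieck_topology C J \<longleftrightarrow>
     (\<forall>x\<in>Obj C. \<forall>R\<in>J x. is_sieve C x R) \<and>
     (\<forall>x\<in>Obj C. {f \<in> Arr C. Cod C f = x} \<in> J x) \<and>
     (\<forall>h\<in>Arr C. \<forall>R\<in>J (Cod C h). pullback_sieve C h R \<in> J (Dom C h)) \<and>
     (\<forall>x\<in>Obj C. \<forall>R\<in>J x. \<forall>R'. is_sieve C x R' \<and>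
        (\<forall>h\<in>R. pullback_sieve C h R' \<in> J (Dom C h)) \<longrightarrow> R' \<in> J x)"

definition is_sheaf :: "('o, 'a) category \<Rightarrow> ('o \<Rightarrow> 'a set set) \<Rightarrow>
    ('o, 'a, 'u set, 'u setarr) func \<Rightarrow> bool" where
  "is_sheaf C J F \<longleftrightarrow> is_functor (op_category C) set_category F \<and>
     (\<forall>x\<in>Obj C. \<forall>R\<in>J x. \<forall>s.
        (\<forall>f\<in>R. s f \<in> fobj F (Dom C f)) \<and>
        (\<forall>f\<in>R. \<forall>g\<in>Arr C. Cod C g = Dom C f \<longrightarrow> cmp (farr F g) (s f) = s (Comp C f g)) \<longrightarrow>
        (\<exists>!y. y \<in> fobj F x \<and> (\<forall>f\<in>R. cmp (farr F f) y = s f)))"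

definition sheaf_category :: "('o, 'a) category \<Rightarrow> ('o \<Rightarrow> 'a set set) \<Rightarrow>
    (('o, 'a, 'u set, 'u setarr) func,
     (('o, 'a, 'u set, 'u setarr) func, 'o \<Rightarrow> 'u setarr) mor) category" where
  "sheaf_category C J =
     full_subcategory (functor_category (op_category C) set_category) (is_sheaf C J)"

definition topos :: "'u itself \<Rightarrow> ('o, 'a) category \<Rightarrow> bool" where
  "topos _ E \<longleftrightarrow> (\<exists>(C :: ('u, 'u) category) J. small_category C \<and> grothendieck_topology C J \<and>
     equivalent E (sheaf_category C J ::
       (('u, 'u, 'u set, 'u setarr) func,
        (('u, 'u, 'u set, 'u setarr) func, 'u \<Rightarrow> 'u setarr) mor) category))"

section \<open>Geometric morphisms\<close>

text \<open>
  In \<open>('o, 'a, 'p, 'b) geom\<close> the first two parameters belong to the domain topos and the last two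
  to the codomain topos.
\<close>

record ('o, 'a, 'p, 'b) geom =
  inv_image :: "('p, 'b, 'o, 'a) func"
  dir_image :: "('o, 'a, 'p, 'b) func"
  adj_unit :: "'p \<Rightarrow> 'b"
  adj_counit :: "'o \<Rightarrow> 'a"

definition geometric_morphism ::
    "('o, 'a) category \<Rightarrow> ('p, 'b) category \<Rightarrow> ('o, 'a, 'p, 'b) geom \<Rightarrow> bool" where
  "geometric_morphism E F f \<longleftrightarrow>
     is_functor F E (inv_image f) \<and> is_functor E F (dir_image f) \<and>
     nat_trans F F (id_functor F) (comp_functor F (dir_image f) (inv_image f)) (adj_unit f) \<and>
     nat_trans E E (comp_functor E (inv_image f) (dir_image f)) (id_functor E) (adj_counit f) \<and>
     (\<forall>x\<in>Obj F. Comp E (adj_counit f (fobj (inv_image f) x)) (farr (inv_image f) (adj_unit f x))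
        = Ident E (fobj (inv_image f) x)) \<and>
     (\<forall>y\<in>Obj E. Comp F (farr (dir_image f) (adj_counit f y)) (adj_unit f (fobj (dir_image f) y))
        = Ident F (fobj (dir_image f) y)) \<and>
     preserves_finite_limits F E (inv_image f)"

definition geometric_equivalence ::
    "('o, 'a) category \<Rightarrow> ('p, 'b) category \<Rightarrow> ('o, 'a, 'p, 'b) geom \<Rightarrow> bool" where
  "geometric_equivalence E F f \<longleftrightarrow> geometric_morphism E F f \<and>
     equivalence F E (inv_image f) \<and> equivalence E F (dir_image f)"

text \<open>The hom-category of the 2-category of topoi.\<close>

definition geom_category :: "('o, 'a) category \<Rightarrow> ('p, 'b) category \<Rightarrow>
    (('o, 'a, 'p, 'b) geom, (('o, 'a, 'p, 'b) geom, 'p \<Rightarrow> 'a) mor) category" where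
  "geom_category E F = \<lparr>Obj = {f. geometric_morphism E F f},
     Arr = {Mor f g \<tau> | f g \<tau>. geometric_morphism E F f \<and> geometric_morphism E F g \<and>
       nat_trans F E (inv_image f) (inv_image g) \<tau>},
     Dom = src, Cod = tgt,
     Ident = (\<lambda>f. Mor f f (\<lambda>x\<in>Obj F. Ident E (fobj (inv_image f) x))),
     Comp = (\<lambda>\<beta> \<alpha>. Mor (src \<alpha>) (tgt \<beta>) (\<lambda>x\<in>Obj F. Comp E (cmp \<beta> x) (cmp \<alpha> x)))\<rparr>"

definition id_geom :: "('o, 'a) category \<Rightarrow> ('o, 'a, 'o, 'a) geom" where
  "id_geom E = \<lparr>inv_image = id_functor E, dir_image = id_functor E,
     adj_unit = (\<lambda>x\<in>Obj E. Ident E x), adj_counit = (\<lambda>x\<in>Obj E. Ident E x)\<rparr>"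

text \<open>The composite of \<open>f : E' \<rightarrow> E\<close> and \<open>p : E \<rightarrow> F\<close>.\<close>

definition comp_geom :: "('n, 'c) category \<Rightarrow> ('p, 'b) category \<Rightarrow>
    ('o, 'a, 'p, 'b) geom \<Rightarrow> ('n, 'c, 'o, 'a) geom \<Rightarrow> ('n, 'c, 'p, 'b) geom" where
  "comp_geom E' F p f = \<lparr>
     inv_image = comp_functor F (inv_image f) (inv_image p),
     dir_image = comp_functor E' (dir_image p) (dir_image f),
     adj_unit = (\<lambda>x\<in>Obj F.
       Comp F (farr (dir_image p) (adj_unit f (fobj (inv_image p) x))) (adj_unit p x)),
     adj_counit = (\<lambda>y\<in>Obj E'.
       Comp E' (adj_counit f y) (farr (inv_image f) (adj_counit p (fobj (dir_image f) y))))\<rparr>"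

section \<open>Sketches and their models\<close>

type_synonym 'u diagram = "('u, 'u) category \<times> ('u, 'u, 'u, 'u) func"

record 'u sketch =
  base :: "('u, 'u) category"
  lim_diagrams :: "'u diagram set"
  colim_diagrams :: "'u diagram set"
  spec_cone :: "'u diagram \<Rightarrow> ('u, 'u, 'u) cone"
  spec_cocone :: "'u diagram \<Rightarrow> ('u, 'u, 'u) cone"

definition is_sketch :: "'u sketch \<Rightarrow> bool" where
  "is_sketch S \<longleftrightarrow> small_category (base S) \<and>
     (\<forall>(I, D)\<in>lim_diagrams S. small_category I \<and> is_functor I (base S) D \<and>
        is_cone I (base S) D (spec_cone S (I, D))) \<and>
     (\<forall>(I, D)\<in>colim_diagrams S. small_category I \<and> is_functor I (base S) D \<and>
        is_cocone I (base S) D (spec_cocone S (I, D)))"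

definition geometric_sketch :: "'u sketch \<Rightarrow> bool" where
  "geometric_sketch S \<longleftrightarrow> is_sketch S \<and> (\<forall>(I, D)\<in>lim_diagrams S. finite_category I)"

definition is_model ::
    "'u sketch \<Rightarrow> ('o, 'a) category \<Rightarrow> ('u, 'u, 'o, 'a) func \<Rightarrow> bool" where
  "is_model S E M \<longleftrightarrow> is_functor (base S) E M \<and>
     (\<forall>(I, D)\<in>lim_diagrams S.
        is_limit_cone I E (comp_functor I M D) (map_cone M (spec_cone S (I, D)))) \<and>
     (\<forall>(I, D)\<in>colim_diagrams S.
        is_colimit_cocone I E (comp_functor I M D) (map_cone M (spec_cocone S (I, D))))"

definition model_category :: "('o, 'a) category \<Rightarrow> 'u sketch \<Rightarrow>
    (('u, 'u, 'o, 'a) func, (('u, 'u, 'o, 'a) func, 'u \<Rightarrow> 'a) mor) category" where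
  "model_category E S = full_subcategory (functor_category (base S) E) (is_model S E)"

abbreviation set_models :: "'u sketch \<Rightarrow> (('u, 'u, 'u set, 'u setarr) func,
    (('u, 'u, 'u set, 'u setarr) func, 'u \<Rightarrow> 'u setarr) mor) category" where
  "set_models S \<equiv> model_category set_category S"

section \<open>Classifying topoi\<close>

text \<open>
  The test topoi \<open>E\<close> below are carried by the types of the category of sets. Since the cardinality
  of \<open>'u\<close> is inaccessible, a small site has at most as many sheaves and sheaf morphisms as there
  are elements of \<open>'u\<close>, so every topos is equivalent to one carried by these types.

  For each test topos \<open>E\<close>, \<open>\<Phi> E\<close> is an equivalence from the geometric morphisms \<open>E \<rightarrow> T\<close> to the
  models in \<open>E\<close>. For \<open>f : E' \<rightarrow> E\<close>, \<open>\<theta> E' E f p\<close> is the component at \<open>p\<close> of an invertible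
  transformation filling the square formed by \<open>\<Phi> E\<close>, \<open>\<Phi> E'\<close>, precomposition with \<open>f\<close> and
  postcomposition with its inverse image.
\<close>

type_synonym 'u test_geom = "('u set, 'u setarr, 'u set, 'u setarr) geom"
type_synonym ('u, 'o, 'a) gen_pt = "('u set, 'u setarr, 'o, 'a) geom"
type_synonym 'u test_model = "('u, 'u, 'u set, 'u setarr) func"

definition pseudonatural :: "'u sketch \<Rightarrow> ('o, 'a) category \<Rightarrow>
    (('u set, 'u setarr) category \<Rightarrow>
      (('u, 'o, 'a) gen_pt, (('u, 'o, 'a) gen_pt, 'o \<Rightarrow> 'u setarr) mor,
       'u test_model, ('u test_model, 'u \<Rightarrow> 'u setarr) mor) func) \<Rightarrow>
    (('u set, 'u setarr) category \<Rightarrow> ('u set, 'u setarr) category \<Rightarrow> 'u test_geom \<Rightarrow>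
      ('u, 'o, 'a) gen_pt \<Rightarrow> ('u test_model, 'u \<Rightarrow> 'u setarr) mor) \<Rightarrow> bool" where
  "pseudonatural S T \<Phi> \<theta> \<longleftrightarrow>
     \<comment> \<open>invertible components\<close>
     (\<forall>E E' f p. topos TYPE('u) E \<and> topos TYPE('u) E' \<and>
        geometric_morphism E' E f \<and> geometric_morphism E T p \<longrightarrow>
        \<theta> E' E f p \<in> hom (model_category E' S)
          (comp_functor (base S) (inv_image f) (fobj (\<Phi> E) p))
          (fobj (\<Phi> E') (comp_geom E' T p f)) \<and>
        is_iso (model_category E' S) (\<theta> E' E f p)) \<and>
     \<comment> \<open>naturality in the 2-cell \<open>\<alpha> : p \<Rightarrow> q\<close>\<close>
     (\<forall>E E' f p q \<alpha>. topos TYPE('u) E \<and> topos TYPE('u) E' \<and>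
        geometric_morphism E' E f \<and> \<alpha> \<in> hom (geom_category E T) p q \<longrightarrow>
        Comp (model_category E' S) (\<theta> E' E f q)
          (Mor (comp_functor (base S) (inv_image f) (fobj (\<Phi> E) p))
               (comp_functor (base S) (inv_image f) (fobj (\<Phi> E) q))
               (\<lambda>s\<in>Obj (base S). farr (inv_image f) (cmp (farr (\<Phi> E) \<alpha>) s))) =
        Comp (model_category E' S)
          (farr (\<Phi> E') (Mor (comp_geom E' T p f) (comp_geom E' T q f)
               (\<lambda>x\<in>Obj T. farr (inv_image f) (cmp \<alpha> x))))
          (\<theta> E' E f p)) \<and>
     \<comment> \<open>naturality in the 2-cell \<open>\<beta> : f \<Rightarrow> g\<close>\<close>
     (\<forall>E E' f g \<beta> p. topos TYPE('u) E \<and> topos TYPE('u) E' \<and>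
        \<beta> \<in> hom (geom_category E' E) f g \<and> geometric_morphism E T p \<longrightarrow>
        Comp (model_category E' S) (\<theta> E' E g p)
          (Mor (comp_functor (base S) (inv_image f) (fobj (\<Phi> E) p))
               (comp_functor (base S) (inv_image g) (fobj (\<Phi> E) p))
               (\<lambda>s\<in>Obj (base S). cmp \<beta> (fobj (fobj (\<Phi> E) p) s))) =
        Comp (model_category E' S)
          (farr (\<Phi> E') (Mor (comp_geom E' T p f) (comp_geom E' T p g)
               (\<lambda>x\<in>Obj T. cmp \<beta> (fobj (inv_image p) x))))
          (\<theta> E' E f p)) \<and>
     \<comment> \<open>compatibility with identities\<close>
     (\<forall>E p. topos TYPE('u) E \<and> geometric_morphism E T p \<longrightarrow>
        \<theta> E E (id_geom E) p = Ident (model_category E S) (fobj (\<Phi> E) p)) \<and>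
     \<comment> \<open>compatibility with composition\<close>
     (\<forall>E E' E'' f g p. topos TYPE('u) E \<and> topos TYPE('u) E' \<and> topos TYPE('u) E'' \<and>
        geometric_morphism E' E f \<and> geometric_morphism E'' E' g \<and> geometric_morphism E T p \<longrightarrow>
        \<theta> E'' E (comp_geom E'' E f g) p =
        Comp (model_category E'' S)
          (\<theta> E'' E' g (comp_geom E' T p f))
          (Mor (comp_functor (base S) (inv_image (comp_geom E'' E f g)) (fobj (\<Phi> E) p))
               (comp_functor (base S) (inv_image g) (fobj (\<Phi> E') (comp_geom E' T p f)))
               (\<lambda>s\<in>Obj (base S). farr (inv_image g) (cmp (\<theta> E' E f p) s))))"

definition classifying_topos :: "'u sketch \<Rightarrow> ('o, 'a) category \<Rightarrow> bool" where
  "classifying_topos S T \<longleftrightarrow> topos TYPE('u) T \<and>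
     (\<exists>\<Phi> \<theta>. (\<forall>E :: ('u set, 'u setarr) category. topos TYPE('u) E \<longrightarrow>
               equivalence (geom_category E T) (model_category E S) (\<Phi> E)) \<and>
             pseudonatural S T \<Phi> \<theta>)"

section \<open>The Scott adjunction\<close>

text \<open>
  The functors between two categories that preserve directed colimits; these are the
  hom-categories of the 2-category of accessible categories with directed colimits. No
  accessibility of \<open>A\<close> is needed for the definition to make sense.
\<close>

definition acc_category :: "'u itself \<Rightarrow> ('o, 'a) category \<Rightarrow> ('p, 'b) category \<Rightarrow>
    (('o, 'a, 'p, 'b) func, (('o, 'a, 'p, 'b) func, 'o \<Rightarrow> 'b) mor) category" where
  "acc_category U A B =
     full_subcategory (functor_category A B) (preserves_directed_colimits U A B)"

definition scott :: "'u itself \<Rightarrow> ('o, 'a) category \<Rightarrow> (('o, 'a, 'u set, 'u setarr) func,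
    (('o, 'a, 'u set, 'u setarr) func, 'o \<Rightarrow> 'u setarr) mor) category" where
  "scott U A = acc_category U A set_category"

type_synonym ('u, 'o, 'a) gen_pt_arr = "(('u, 'o, 'a) gen_pt, 'o \<Rightarrow> 'u setarr) mor"

definition points :: "'u itself \<Rightarrow> ('o, 'a) category \<Rightarrow>
    (('u, 'o, 'a) gen_pt, ('u, 'o, 'a) gen_pt_arr) category" where
  "points _ E = geom_category set_category E"

text \<open>Objects and arrows of the Scott topos of the category of points.\<close>

type_synonym ('u, 'o, 'a) scott_obj =
  "(('u, 'o, 'a) gen_pt, ('u, 'o, 'a) gen_pt_arr, 'u set, 'u setarr) func"
type_synonym ('u, 'o, 'a) scott_arr =
  "(('u, 'o, 'a) scott_obj, ('u, 'o, 'a) gen_pt \<Rightarrow> 'u setarr) mor"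

definition evaluation :: "'u itself \<Rightarrow> ('o, 'a) category \<Rightarrow> 'o \<Rightarrow> ('u, 'o, 'a) scott_obj" where
  "evaluation U E e = \<lparr>fobj = (\<lambda>p\<in>Obj (points U E). fobj (inv_image p) e),
     farr = (\<lambda>\<alpha>\<in>Arr (points U E). cmp \<alpha> e)\<rparr>"

definition scott_counit_inv_image :: "'u itself \<Rightarrow> ('o, 'a) category \<Rightarrow>
    ('o, 'a, ('u, 'o, 'a) scott_obj, ('u, 'o, 'a) scott_arr) func" where
  "scott_counit_inv_image U E = \<lparr>fobj = (\<lambda>e\<in>Obj E. evaluation U E e),
     farr = (\<lambda>u\<in>Arr E. Mor (evaluation U E (Dom E u)) (evaluation U E (Cod E u))
       (\<lambda>p\<in>Obj (points U E). farr (inv_image p) u))\<rparr>"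

text \<open>The inverse image determines the counit up to isomorphism of geometric morphisms.\<close>

definition is_scott_counit :: "'u itself \<Rightarrow> ('o, 'a) category \<Rightarrow>
    (('u, 'o, 'a) scott_obj, ('u, 'o, 'a) scott_arr, 'o, 'a) geom \<Rightarrow> bool" where
  "is_scott_counit U E \<epsilon> \<longleftrightarrow> geometric_morphism (scott U (points U E)) E \<epsilon> \<and>
     inv_image \<epsilon> = scott_counit_inv_image U E"

end

theory Submission
  imports Defs
begin

text \<open>
  The category of sets is a topos (sheaves on the one-arrow category), so it may be used as a test
  topos in the universal property of \<open>T\<close>: the points of \<open>T\<close> are equivalent to the models of \<open>S\<close> in
  sets. An equivalence of categories preserves all colimits, so precomposition with it
  is an equivalence between the Scott topoi. Hence the Scott topos of the models is equivalent to
  that of the points, which the counit identifies with \<open>T\<close>.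
\<close>

section \<open>Categories and functors\<close>

text \<open>An equivalence is given by a pseudo-inverse and two natural isomorphisms that are not
  assumed to satisfy the triangle identities, so no adjunction is at hand from which preservation of
  colimits could be read off. The route taken is through fullness, faithfulness and essential
  surjectivity: a cone over the image diagram is lifted, up to isomorphism of its apex, to a cone
  over the original diagram. This is done for limits of any shape, and colimits are limits in
  opposite categories. Preservation is needed for the equivalence and for its pseudo-inverse, since
  precomposition with either has to stay among the functors that preserve directed colimits.

  Directions matter. The universal property gives a functor from points to models, but
  precomposition is contravariant, so the pseudo-inverse of that functor is the one to precompose
  with.

  Functors are \<open>undefined\<close> off their domain, so composition is strictly associative and
  unital, and whiskered isomorphisms compose without coherence isomorphisms.\<close>

lemma hom_objD:
  assumes "is_category C" "f \<in> hom C x y"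
  shows "x \<in> Obj C" "y \<in> Obj C"
  using assms by (auto simp: is_category_def hom_def)

lemma hom_arrD:
  assumes "f \<in> hom C x y"
  shows "f \<in> Arr C" "Dom C f = x" "Cod C f = y"
  using assms by (auto simp: hom_def)

lemma arr_hom: "f \<in> Arr C \<Longrightarrow> f \<in> hom C (Dom C f) (Cod C f)"
  by (simp add: hom_def)

lemma arr_obj:
  assumes "is_category C" "f \<in> Arr C"
  shows "Dom C f \<in> Obj C" "Cod C f \<in> Obj C"
  using assms by (auto simp: is_category_def)

lemma ident_hom: "is_category C \<Longrightarrow> x \<in> Obj C \<Longrightarrow> Ident C x \<in> hom C x x"
  by (simp add: is_category_def)

lemma comp_hom:
  "is_category C \<Longrightarrow> f \<in> hom C x y \<Longrightarrow> g \<in> hom C y z \<Longrightarrow> Comp C g f \<in> hom C x z"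
  unfolding is_category_def by (metis hom_arrD)

lemma comp_assoc:
  "is_category C \<Longrightarrow> f \<in> hom C x y \<Longrightarrow> g \<in> hom C y z \<Longrightarrow> h \<in> hom C z w \<Longrightarrow>
    Comp C (Comp C h g) f = Comp C h (Comp C g f)"
  unfolding is_category_def by (metis hom_arrD)

lemma comp_ident:
  assumes "is_category C" "f \<in> hom C x y"
  shows "Comp C f (Ident C x) = f" "Comp C (Ident C y) f = f"
  using assms unfolding is_category_def by (metis hom_arrD)+

text \<open>Naming the objects through hom-sets replaces the composability equations on
  \<open>Dom\<close> and \<open>Cod\<close>, so that composites in the later constructions are typed
  by chaining \<open>comp_hom\<close>.\<close>

lemma is_categoryI:
  assumes "\<And>f. f \<in> Arr C \<Longrightarrow> Dom C f \<in> Obj C" "\<And>f. f \<in> Arr C \<Longrightarrow> Cod C f \<in> Obj C"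
    and "\<And>x. x \<in> Obj C \<Longrightarrow> Ident C x \<in> hom C x x"
    and "\<And>x y z f g. f \<in> hom C x y \<Longrightarrow> g \<in> hom C y z \<Longrightarrow> Comp C g f \<in> hom C x z"
    and "\<And>x y f. f \<in> hom C x y \<Longrightarrow> Comp C f (Ident C x) = f"
    and "\<And>x y f. f \<in> hom C x y \<Longrightarrow> Comp C (Ident C y) f = f"
    and "\<And>x y z w f g h. f \<in> hom C x y \<Longrightarrow> g \<in> hom C y z \<Longrightarrow> h \<in> hom C z w \<Longrightarrow>
      Comp C h (Comp C g f) = Comp C (Comp C h g) f"
  shows "is_category C"
  unfolding is_category_def
proof (intro conjI ballI impI)
  fix f assume f: "f \<in> Arr C"
  then have h: "f \<in> hom C (Dom C f) (Cod C f)" by (rule arr_hom)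
  show "Comp C f (Ident C (Dom C f)) = f" "Comp C (Ident C (Cod C f)) f = f"
    using assms(5,6) h by blast+
  show "Dom C f \<in> Obj C" "Cod C f \<in> Obj C" using assms(1,2) f by blast+
  fix g assume g: "g \<in> Arr C" and dg: "Dom C g = Cod C f"
  then have hg: "g \<in> hom C (Cod C f) (Cod C g)" by (simp add: hom_def)
  show "Comp C g f \<in> hom C (Dom C f) (Cod C g)" using assms(4) h hg by blast
next
  fix f g h
  assume "f \<in> Arr C" "g \<in> Arr C" "h \<in> Arr C" "Dom C g = Cod C f \<and> Dom C h = Cod C g"
  then have "f \<in> hom C (Dom C f) (Cod C f)" "g \<in> hom C (Cod C f) (Cod C g)"
    "h \<in> hom C (Cod C g) (Cod C h)" by (auto simp: hom_def)
  then show "Comp C h (Comp C g f) = Comp C (Comp C h g) f" by (rule assms(7))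
qed (use assms(3) in blast)

lemma is_functor_dom: "is_functor C D F \<Longrightarrow> is_category C"
  and is_functor_cod: "is_functor C D F \<Longrightarrow> is_category D"
  and functor_obj: "is_functor C D F \<Longrightarrow> x \<in> Obj C \<Longrightarrow> fobj F x \<in> Obj D"
  and functor_arr: "is_functor C D F \<Longrightarrow> f \<in> Arr C \<Longrightarrow> farr F f \<in> Arr D"
  and functor_ident:
    "is_functor C D F \<Longrightarrow> x \<in> Obj C \<Longrightarrow> farr F (Ident C x) = Ident D (fobj F x)"
  unfolding is_functor_def by auto

lemma functor_hom:
  "is_functor C D F \<Longrightarrow> f \<in> hom C x y \<Longrightarrow> farr F f \<in> hom D (fobj F x) (fobj F y)"
  unfolding is_functor_def by (metis hom_arrD)

lemma functor_comp:
  "is_functor C D F \<Longrightarrow> f \<in> hom C x y \<Longrightarrow> g \<in> hom C y z \<Longrightarrow>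
    farr F (Comp C g f) = Comp D (farr F g) (farr F f)"
  unfolding is_functor_def by (metis hom_arrD)

lemma is_functorI:
  assumes "is_category C" "is_category D"
    and "fobj F \<in> extensional (Obj C)" "farr F \<in> extensional (Arr C)"
    and "\<And>x. x \<in> Obj C \<Longrightarrow> fobj F x \<in> Obj D"
    and hom: "\<And>f x y. f \<in> hom C x y \<Longrightarrow> farr F f \<in> hom D (fobj F x) (fobj F y)"
    and "\<And>x. x \<in> Obj C \<Longrightarrow> farr F (Ident C x) = Ident D (fobj F x)"
    and comp: "\<And>f g x y z. f \<in> hom C x y \<Longrightarrow> g \<in> hom C y z \<Longrightarrow>
      farr F (Comp C g f) = Comp D (farr F g) (farr F f)"
  shows "is_functor C D F"
  unfolding is_functor_def
proof (intro conjI ballI impI)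
  show "farr F \<in> Arr C \<rightarrow>\<^sub>E Arr D"
    using assms(4) hom[OF arr_hom] by (auto simp: PiE_def dest: hom_arrD(1))
  show "farr F f \<in> hom D (fobj F (Dom C f)) (fobj F (Cod C f))" if "f \<in> Arr C" for f
    using hom[OF arr_hom[OF that]] .
  show "farr F (Comp C g f) = Comp D (farr F g) (farr F f)"
    if "f \<in> Arr C" "g \<in> Arr C" "Dom C g = Cod C f" for f g
    using comp[OF arr_hom[OF that(1)]] that by (simp add: hom_def)
qed (use assms in \<open>auto simp: PiE_def\<close>)

text \<open>Both records are \<open>undefined\<close> off \<open>C\<close>, so agreement on
  \<open>C\<close> forces equality. The codomain is no part of the record, hence \<open>D\<close>
  and \<open>D'\<close> may differ.\<close>

lemma func_eqI:
  fixes F G :: "('o, 'a, 'p, 'b) func"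
  assumes "is_functor C D F" "is_functor C D' G"
    and "\<And>x. x \<in> Obj C \<Longrightarrow> fobj F x = fobj G x" "\<And>f. f \<in> Arr C \<Longrightarrow> farr F f = farr G f"
  shows "F = G"
proof -
  have "fobj F \<in> extensional (Obj C)" "fobj G \<in> extensional (Obj C)"
    "farr F \<in> extensional (Arr C)" "farr G \<in> extensional (Arr C)"
    using assms(1,2) by (simp_all add: is_functor_def PiE_def)
  then have "fobj F = fobj G" "farr F = farr G"
    using assms(3,4) by (blast intro: extensionalityI)+
  then show ?thesis by simp
qed

lemma id_functor_simps [simp]:
  "x \<in> Obj C \<Longrightarrow> fobj (id_functor C) x = x" "f \<in> Arr C \<Longrightarrow> farr (id_functor C) f = f"
  by (simp_all add: id_functor_def)

lemma comp_functor_simps [simp]: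
  "x \<in> Obj C \<Longrightarrow> fobj (comp_functor C G F) x = fobj G (fobj F x)"
  "f \<in> Arr C \<Longrightarrow> farr (comp_functor C G F) f = farr G (farr F f)"
  by (simp_all add: comp_functor_def)

lemma is_functor_id: "is_category C \<Longrightarrow> is_functor C C (id_functor C)"
  by (rule is_functorI)
    (auto simp: id_functor_def ident_hom comp_hom hom_arrD dest: hom_objD hom_arrD
      intro: hom_arrD(1)[OF ident_hom] hom_arrD(1)[OF comp_hom])

lemma is_functor_comp:
  assumes F: "is_functor C D F" and G: "is_functor D E G"
  shows "is_functor C E (comp_functor C G F)"
proof -
  note C = is_functor_dom[OF F]
  show ?thesis
  proof (rule is_functorI)
    fix f x y assume f: "f \<in> hom C x y"
    have fobj_eq: "fobj (comp_functor C G F) x = fobj G (fobj F x)"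
      "fobj (comp_functor C G F) y = fobj G (fobj F y)"
      using hom_objD[OF C f] by simp_all
    show "farr (comp_functor C G F) f
        \<in> hom E (fobj (comp_functor C G F) x) (fobj (comp_functor C G F) y)"
      unfolding fobj_eq using functor_hom[OF G functor_hom[OF F f]] hom_arrD[OF f] by simp
  next
    fix x assume x: "x \<in> Obj C"
    then show "farr (comp_functor C G F) (Ident C x) = Ident E (fobj (comp_functor C G F) x)"
      using hom_arrD(1)[OF ident_hom[OF C x]]
      by (simp add: functor_ident[OF F] functor_ident[OF G] functor_obj[OF F])
  next
    fix f g x y z assume f: "f \<in> hom C x y" and g: "g \<in> hom C y z"
    show "farr (comp_functor C G F) (Comp C g f)
        = Comp E (farr (comp_functor C G F) g) (farr (comp_functor C G F) f)"
      using hom_arrD(1)[OF comp_hom[OF C f g]] hom_arrD[OF f] hom_arrD[OF g]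
        functor_comp[OF G functor_hom[OF F f] functor_hom[OF F g]]
      by (simp add: functor_comp[OF F f g])
  qed (use F G C in \<open>auto simp: is_functor_cod functor_obj comp_functor_def\<close>)
qed

text \<open>Since \<open>F\<close> lands in \<open>D\<close>, the restricted composite
  \<open>comp_functor D H G\<close> is never evaluated where it is \<open>undefined\<close>, and the
  law is an equality of records.\<close>

lemma comp_functor_assoc:
  assumes "is_functor C D F"
  shows "comp_functor C (comp_functor D H G) F = comp_functor C H (comp_functor C G F)"
  using functor_obj[OF assms] functor_arr[OF assms]
  by (auto simp: comp_functor_def restrict_def fun_eq_iff)

lemma comp_functor_id_right:
  assumes "is_functor C D F"
  shows "comp_functor C F (id_functor C) = F"
  by (rule func_eqI[OF is_functor_comp[OF is_functor_id assms] assms])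
    (use is_functor_dom[OF assms] in auto)

lemma comp_functor_id_left:
  assumes "is_functor C D F"
  shows "comp_functor C (id_functor D) F = F"
  by (rule func_eqI[OF is_functor_comp[OF assms is_functor_id] assms])
    (use assms in \<open>auto simp: is_functor_cod functor_obj functor_arr\<close>)

section \<open>Isomorphisms\<close>

lemma is_isoE:
  assumes "f \<in> hom C x y" "is_iso C f"
  obtains g where "g \<in> hom C y x" "Comp C g f = Ident C x" "Comp C f g = Ident C y"
  using assms by (auto simp: is_iso_def hom_def)

lemma is_isoI:
  assumes "f \<in> hom C x y" "g \<in> hom C y x" "Comp C g f = Ident C x" "Comp C f g = Ident C y"
  shows "is_iso C f"
  using assms unfolding is_iso_def by (auto dest: hom_arrD)

lemma functor_iso:
  assumes F: "is_functor C D F" and f: "f \<in> hom C x y" and "is_iso C f"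
  shows "is_iso D (farr F f)"
proof -
  note C = is_functor_dom[OF F]
  obtain g where g: "g \<in> hom C y x" "Comp C g f = Ident C x" "Comp C f g = Ident C y"
    using is_isoE[OF f assms(3)] .
  show ?thesis
    by (rule is_isoI[OF functor_hom[OF F f] functor_hom[OF F g(1)]])
      (use hom_objD[OF C f] in \<open>simp_all add: functor_comp[OF F f g(1), symmetric]
        functor_comp[OF F g(1) f, symmetric] g functor_ident[OF F]\<close>)
qed

lemma iso_comp:
  assumes C: "is_category C" and f: "f \<in> hom C x y" "is_iso C f" and g: "g \<in> hom C y z" "is_iso C g"
  shows "is_iso C (Comp C g f)"
proof -
  obtain f' where f': "f' \<in> hom C y x" "Comp C f' f = Ident C x" "Comp C f f' = Ident C y"
    using is_isoE[OF f] .
  obtain g' where g': "g' \<in> hom C z y" "Comp C g' g = Ident C y" "Comp C g g' = Ident C z"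
    using is_isoE[OF g] .
  have "Comp C (Comp C f' g') (Comp C g f) = Comp C f' (Comp C (Comp C g' g) f)"
    using comp_assoc[OF C comp_hom[OF C f(1) g(1)] g'(1) f'(1)] comp_assoc[OF C f(1) g(1) g'(1)]
    by simp
  also have "\<dots> = Ident C x" using comp_ident[OF C f(1)] by (simp add: g' f')
  finally have 1: "Comp C (Comp C f' g') (Comp C g f) = Ident C x" .
  have "Comp C (Comp C g f) (Comp C f' g') = Comp C g (Comp C (Comp C f f') g')"
    using comp_assoc[OF C comp_hom[OF C g'(1) f'(1)] f(1) g(1)] comp_assoc[OF C g'(1) f'(1) f(1)]
    by simp
  also have "\<dots> = Ident C z" using comp_ident[OF C g'(1)] by (simp add: g' f')
  finally have 2: "Comp C (Comp C g f) (Comp C f' g') = Ident C z" .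
  show ?thesis
    by (rule is_isoI[OF comp_hom[OF C f(1) g(1)] comp_hom[OF C g'(1) f'(1)] 1 2])
qed

lemma iso_cancel_left:
  assumes C: "is_category C" and h: "h \<in> hom C y z" "is_iso C h"
    and f: "f \<in> hom C x y" and g: "g \<in> hom C x y" and eq: "Comp C h f = Comp C h g"
  shows "f = g"
proof -
  obtain k where k: "k \<in> hom C z y" "Comp C k h = Ident C y" using is_isoE[OF h] .
  have "f = Comp C k (Comp C h f)"
    using comp_assoc[OF C f h(1) k(1)] comp_ident[OF C f] k by simp
  also have "\<dots> = g"
    using comp_assoc[OF C g h(1) k(1)] comp_ident[OF C g] k eq by simp
  finally show ?thesis .
qed

lemma iso_cancel_right:
  assumes C: "is_category C" and h: "h \<in> hom C x y" "is_iso C h"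
    and f: "f \<in> hom C y z" and g: "g \<in> hom C y z" and eq: "Comp C f h = Comp C g h"
  shows "f = g"
proof -
  obtain k where k: "k \<in> hom C y x" "Comp C h k = Ident C y" using is_isoE[OF h] .
  have "f = Comp C (Comp C f h) k"
    using comp_assoc[OF C k(1) h(1) f] comp_ident[OF C f] k by simp
  also have "\<dots> = g"
    using comp_assoc[OF C k(1) h(1) g] comp_ident[OF C g] k eq by simp
  finally show ?thesis .
qed

section \<open>Natural isomorphisms\<close>

text \<open>Invertibility is asked componentwise, a form that whiskering visibly preserves;
  \<open>isomorphic_functor_category\<close> identifies it with isomorphism in the functor
  category.\<close>

definition nat_iso :: "('o, 'a) category \<Rightarrow> ('p, 'b) category \<Rightarrow> ('o, 'a, 'p, 'b) func \<Rightarrow>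
    ('o, 'a, 'p, 'b) func \<Rightarrow> ('o \<Rightarrow> 'b) \<Rightarrow> bool" where
  "nat_iso C D F G \<tau> \<longleftrightarrow> nat_trans C D F G \<tau> \<and> (\<forall>x\<in>Obj C. is_iso D (\<tau> x))"

lemma nat_transD:
  assumes "nat_trans C D F G \<tau>"
  shows "is_functor C D F" "is_functor C D G" "\<tau> \<in> extensional (Obj C)"
    "\<And>x. x \<in> Obj C \<Longrightarrow> \<tau> x \<in> hom D (fobj F x) (fobj G x)"
    "\<And>f x y. f \<in> hom C x y \<Longrightarrow> Comp D (\<tau> y) (farr F f) = Comp D (farr G f) (\<tau> x)"
  using assms by (auto simp: nat_trans_def hom_def)

lemma nat_transI:
  assumes "is_functor C D F" "is_functor C D G" "\<tau> \<in> extensional (Obj C)"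
    "\<And>x. x \<in> Obj C \<Longrightarrow> \<tau> x \<in> hom D (fobj F x) (fobj G x)"
    "\<And>f x y. f \<in> hom C x y \<Longrightarrow> Comp D (\<tau> y) (farr F f) = Comp D (farr G f) (\<tau> x)"
  shows "nat_trans C D F G \<tau>"
  using assms by (auto simp: nat_trans_def arr_hom)

lemma nat_trans_ident:
  assumes F: "is_functor C D F"
  shows "nat_trans C D F F (\<lambda>x\<in>Obj C. Ident D (fobj F x))"
proof (rule nat_transI[OF F F])
  note C = is_functor_dom[OF F] and D = is_functor_cod[OF F]
  fix f x y assume f: "f \<in> hom C x y"
  show "Comp D ((\<lambda>x\<in>Obj C. Ident D (fobj F x)) y) (farr F f)
      = Comp D (farr F f) ((\<lambda>x\<in>Obj C. Ident D (fobj F x)) x)"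
    using hom_objD[OF C f] comp_ident[OF D functor_hom[OF F f]] by simp
qed (use F in \<open>auto intro: ident_hom is_functor_cod functor_obj\<close>)

lemma nat_trans_comp:
  assumes \<sigma>: "nat_trans C D F G \<sigma>" and \<tau>: "nat_trans C D G H \<tau>"
  shows "nat_trans C D F H (\<lambda>x\<in>Obj C. Comp D (\<tau> x) (\<sigma> x))"
proof (rule nat_transI)
  note F = nat_transD(1)[OF \<sigma>] and G = nat_transD(1)[OF \<tau>] and H = nat_transD(2)[OF \<tau>]
  note C = is_functor_dom[OF F] and D = is_functor_cod[OF F]
  show "is_functor C D F" "is_functor C D H" by fact+
  show "(\<lambda>x\<in>Obj C. Comp D (\<tau> x) (\<sigma> x)) x \<in> hom D (fobj F x) (fobj H x)" if "x \<in> Obj C" for x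
    using comp_hom[OF D nat_transD(4)[OF \<sigma> that] nat_transD(4)[OF \<tau> that]] that by simp
  fix f x y assume f: "f \<in> hom C x y"
  note x = hom_objD(1)[OF C f] and y = hom_objD(2)[OF C f]
  note \<sigma>x = nat_transD(4)[OF \<sigma> x] and \<sigma>y = nat_transD(4)[OF \<sigma> y]
    and \<tau>x = nat_transD(4)[OF \<tau> x] and \<tau>y = nat_transD(4)[OF \<tau> y]
  have "Comp D (Comp D (\<tau> y) (\<sigma> y)) (farr F f) = Comp D (\<tau> y) (Comp D (farr G f) (\<sigma> x))"
    using comp_assoc[OF D functor_hom[OF F f] \<sigma>y \<tau>y] nat_transD(5)[OF \<sigma> f] by simp
  also have "\<dots> = Comp D (farr H f) (Comp D (\<tau> x) (\<sigma> x))"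
    using comp_assoc[OF D \<sigma>x functor_hom[OF G f] \<tau>y] nat_transD(5)[OF \<tau> f]
      comp_assoc[OF D \<sigma>x \<tau>x functor_hom[OF H f]] by simp
  finally show "Comp D ((\<lambda>x\<in>Obj C. Comp D (\<tau> x) (\<sigma> x)) y) (farr F f)
      = Comp D (farr H f) ((\<lambda>x\<in>Obj C. Comp D (\<tau> x) (\<sigma> x)) x)"
    using x y by simp
qed simp

lemma nat_iso_refl:
  assumes F: "is_functor C D F"
  shows "nat_iso C D F F (\<lambda>x\<in>Obj C. Ident D (fobj F x))"
  unfolding nat_iso_def
proof (intro conjI ballI nat_trans_ident[OF F])
  fix x assume x: "x \<in> Obj C"
  note D = is_functor_cod[OF F]
  have i: "Ident D (fobj F x) \<in> hom D (fobj F x) (fobj F x)"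
    using ident_hom[OF D functor_obj[OF F x]] .
  show "is_iso D ((\<lambda>x\<in>Obj C. Ident D (fobj F x)) x)"
    using is_isoI[OF i i] comp_ident[OF D i] x by simp
qed

lemma nat_iso_comp:
  assumes \<sigma>: "nat_iso C D F G \<sigma>" and \<tau>: "nat_iso C D G H \<tau>"
  shows "nat_iso C D F H (\<lambda>x\<in>Obj C. Comp D (\<tau> x) (\<sigma> x))"
  using assms unfolding nat_iso_def
  by (auto intro!: nat_trans_comp iso_comp[OF is_functor_cod[OF nat_transD(1)]]
      intro: nat_transD(4))

lemma nat_iso_inverse:
  assumes "nat_iso C D F G \<tau>"
  obtains \<sigma> where "nat_iso C D G F \<sigma>"
    "\<And>x. x \<in> Obj C \<Longrightarrow> Comp D (\<sigma> x) (\<tau> x) = Ident D (fobj F x)"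
    "\<And>x. x \<in> Obj C \<Longrightarrow> Comp D (\<tau> x) (\<sigma> x) = Ident D (fobj G x)"
proof -
  have \<tau>: "nat_trans C D F G \<tau>" and iso: "\<And>x. x \<in> Obj C \<Longrightarrow> is_iso D (\<tau> x)"
    using assms by (auto simp: nat_iso_def)
  note F = nat_transD(1)[OF \<tau>] and G = nat_transD(2)[OF \<tau>]
  note C = is_functor_dom[OF F] and D = is_functor_cod[OF F]
  have "\<forall>x\<in>Obj C. \<exists>g. g \<in> hom D (fobj G x) (fobj F x) \<and>
      Comp D g (\<tau> x) = Ident D (fobj F x) \<and> Comp D (\<tau> x) g = Ident D (fobj G x)"
    using is_isoE[OF nat_transD(4)[OF \<tau>] iso] by metis
  then obtain \<rho> where \<rho>: "\<And>x. x \<in> Obj C \<Longrightarrow> \<rho> x \<in> hom D (fobj G x) (fobj F x)"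
    "\<And>x. x \<in> Obj C \<Longrightarrow> Comp D (\<rho> x) (\<tau> x) = Ident D (fobj F x)"
    "\<And>x. x \<in> Obj C \<Longrightarrow> Comp D (\<tau> x) (\<rho> x) = Ident D (fobj G x)"
    by metis
  \<comment> \<open>The inverses were chosen pointwise. Their naturality square commutes because it
    does so after composition with the invertible \<open>\<tau> y\<close>.\<close>
  have nat: "Comp D (\<rho> y) (farr G f) = Comp D (farr F f) (\<rho> x)" if f: "f \<in> hom C x y" for f x y
  proof (rule iso_cancel_left[OF D])
    note x = hom_objD(1)[OF C f] and y = hom_objD(2)[OF C f]
    note Ff = functor_hom[OF F f] and Gf = functor_hom[OF G f]
    note \<tau>x = nat_transD(4)[OF \<tau> x] and \<tau>y = nat_transD(4)[OF \<tau> y]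
    show "\<tau> y \<in> hom D (fobj F y) (fobj G y)" "is_iso D (\<tau> y)" by (rule \<tau>y, rule iso[OF y])
    show "Comp D (\<rho> y) (farr G f) \<in> hom D (fobj G x) (fobj F y)"
      "Comp D (farr F f) (\<rho> x) \<in> hom D (fobj G x) (fobj F y)"
      by (rule comp_hom[OF D Gf \<rho>(1)[OF y]], rule comp_hom[OF D \<rho>(1)[OF x] Ff])
    have "Comp D (\<tau> y) (Comp D (\<rho> y) (farr G f)) = farr G f"
      using comp_assoc[OF D Gf \<rho>(1)[OF y] \<tau>y] \<rho>(3)[OF y] comp_ident[OF D Gf] by simp
    also have "\<dots> = Comp D (Comp D (farr G f) (\<tau> x)) (\<rho> x)"
      using comp_assoc[OF D \<rho>(1)[OF x] \<tau>x Gf] \<rho>(3)[OF x] comp_ident[OF D Gf] by simp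
    also have "\<dots> = Comp D (\<tau> y) (Comp D (farr F f) (\<rho> x))"
      using comp_assoc[OF D \<rho>(1)[OF x] Ff \<tau>y] nat_transD(5)[OF \<tau> f] by simp
    finally show "Comp D (\<tau> y) (Comp D (\<rho> y) (farr G f)) = Comp D (\<tau> y) (Comp D (farr F f) (\<rho> x))" .
  qed
  \<comment> \<open>The chosen \<open>\<rho>\<close> is arbitrary off \<open>Obj C\<close>;
    restricting it gives the extensionality that \<open>nat_trans\<close> demands.\<close>
  have "nat_iso C D G F (restrict \<rho> (Obj C))"
    unfolding nat_iso_def
  proof (intro conjI ballI nat_transI[OF G F])
    show "is_iso D (restrict \<rho> (Obj C) x)" if "x \<in> Obj C" for x
      using is_isoI[OF \<rho>(1)[OF that] nat_transD(4)[OF \<tau> that]] \<rho>[OF that] that by simp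
  qed (use \<rho> nat hom_objD[OF C] in auto)
  then show thesis by (rule that) (use \<rho> in auto)
qed

lemma nat_iso_whisker_left:
  assumes \<tau>: "nat_iso C D F G \<tau>" and H: "is_functor D E H"
  shows "nat_iso C E (comp_functor C H F) (comp_functor C H G) (\<lambda>x\<in>Obj C. farr H (\<tau> x))"
proof -
  have nt: "nat_trans C D F G \<tau>" and iso: "\<And>x. x \<in> Obj C \<Longrightarrow> is_iso D (\<tau> x)"
    using \<tau> by (auto simp: nat_iso_def)
  note F = nat_transD(1)[OF nt] and G = nat_transD(2)[OF nt]
  note C = is_functor_dom[OF F]
  show ?thesis
    unfolding nat_iso_def
  proof (intro conjI ballI nat_transI is_functor_comp[OF F H] is_functor_comp[OF G H])
    fix f x y assume f: "f \<in> hom C x y"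
    note x = hom_objD(1)[OF C f] and y = hom_objD(2)[OF C f]
    show "Comp E ((\<lambda>x\<in>Obj C. farr H (\<tau> x)) y) (farr (comp_functor C H F) f)
        = Comp E (farr (comp_functor C H G) f) ((\<lambda>x\<in>Obj C. farr H (\<tau> x)) x)"
      using x y hom_arrD[OF f] functor_comp[OF H functor_hom[OF F f] nat_transD(4)[OF nt y]]
        functor_comp[OF H nat_transD(4)[OF nt x] functor_hom[OF G f]] nat_transD(5)[OF nt f]
      by simp
  qed (use nt iso in \<open>auto intro: functor_iso[OF H] functor_hom[OF H] nat_transD(4)\<close>)
qed

lemma nat_trans_whisker_right:
  assumes \<tau>: "nat_trans D E F G \<tau>" and H: "is_functor C D H"
  shows "nat_trans C E (comp_functor C F H) (comp_functor C G H) (\<lambda>x\<in>Obj C. \<tau> (fobj H x))"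
proof (intro nat_transI)
  note C = is_functor_dom[OF H]
  fix f x y assume f: "f \<in> hom C x y"
  show "Comp E ((\<lambda>x\<in>Obj C. \<tau> (fobj H x)) y) (farr (comp_functor C F H) f)
      = Comp E (farr (comp_functor C G H) f) ((\<lambda>x\<in>Obj C. \<tau> (fobj H x)) x)"
    using hom_objD[OF C f] hom_arrD[OF f] nat_transD(5)[OF \<tau> functor_hom[OF H f]] by simp
qed (use \<tau> H in \<open>auto intro: functor_obj nat_transD(4) is_functor_comp dest: nat_transD(1,2)\<close>)

lemma nat_iso_whisker_right:
  assumes "nat_iso D E F G \<tau>" "is_functor C D H"
  shows "nat_iso C E (comp_functor C F H) (comp_functor C G H) (\<lambda>x\<in>Obj C. \<tau> (fobj H x))"
  using assms unfolding nat_iso_def by (auto intro: nat_trans_whisker_right functor_obj)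

section \<open>Functor categories and full subcategories\<close>

lemma hom_functor_category:
  "hom (functor_category C D) F G = {Mor F G \<tau> | \<tau>. nat_trans C D F G \<tau>}"
  by (auto simp: hom_def functor_category_def)

lemma is_category_functor_category:
  assumes C: "is_category C" and D: "is_category D"
  shows "is_category (functor_category C D)"
proof (rule is_categoryI)
  fix F assume "F \<in> Obj (functor_category C D)"
  then show "Ident (functor_category C D) F \<in> hom (functor_category C D) F F"
    unfolding hom_functor_category using nat_trans_ident
    by (auto simp: functor_category_def)
next
  fix F G H \<alpha> \<beta> assume "\<alpha> \<in> hom (functor_category C D) F G" "\<beta> \<in> hom (functor_category C D) G H"
  then show "Comp (functor_category C D) \<beta> \<alpha> \<in> hom (functor_category C D) F H"
    unfolding hom_functor_category using nat_trans_comp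
    by (force simp: functor_category_def)
next
  fix F G \<alpha> assume "\<alpha> \<in> hom (functor_category C D) F G"
  then obtain \<tau> where \<alpha>: "\<alpha> = Mor F G \<tau>" and \<tau>: "nat_trans C D F G \<tau>"
    unfolding hom_functor_category by blast
  \<comment> \<open>The unit laws are equalities of functions on a whole type; off
    \<open>Obj C\<close> both sides are \<open>undefined\<close>.\<close>
  note e = extensional_arb[OF nat_transD(3)[OF \<tau>]]
  show "Comp (functor_category C D) \<alpha> (Ident (functor_category C D) F) = \<alpha>"
    "Comp (functor_category C D) (Ident (functor_category C D) G) \<alpha> = \<alpha>"
    using comp_ident[OF D nat_transD(4)[OF \<tau>]] e
    by (auto simp: \<alpha> functor_category_def restrict_def fun_eq_iff)
next
  fix F G H K \<alpha> \<beta> \<gamma>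
  assume "\<alpha> \<in> hom (functor_category C D) F G" "\<beta> \<in> hom (functor_category C D) G H"
    "\<gamma> \<in> hom (functor_category C D) H K"
  then obtain a b c where "\<alpha> = Mor F G a" "\<beta> = Mor G H b" "\<gamma> = Mor H K c"
    and abc: "nat_trans C D F G a" "nat_trans C D G H b" "nat_trans C D H K c"
    unfolding hom_functor_category by blast
  then show "Comp (functor_category C D) \<gamma> (Comp (functor_category C D) \<beta> \<alpha>)
      = Comp (functor_category C D) (Comp (functor_category C D) \<gamma> \<beta>) \<alpha>"
    using comp_assoc[OF D nat_transD(4)[OF abc(1)] nat_transD(4)[OF abc(2)] nat_transD(4)[OF abc(3)]]
    by (auto simp: functor_category_def restrict_def fun_eq_iff)
qed (auto simp: functor_category_def dest: nat_transD)

text \<open>The inverse is delivered as an arrow of the functor category together with its two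
  equations, the form in which invertibility passes to full subcategories.\<close>

lemma nat_iso_inverse_mor:
  assumes "nat_iso C D F G \<tau>"
  obtains \<sigma> where "nat_trans C D G F \<sigma>"
    "Comp (functor_category C D) (Mor G F \<sigma>) (Mor F G \<tau>) = Ident (functor_category C D) F"
    "Comp (functor_category C D) (Mor F G \<tau>) (Mor G F \<sigma>) = Ident (functor_category C D) G"
proof -
  obtain \<sigma> where \<sigma>: "nat_iso C D G F \<sigma>"
    "\<And>x. x \<in> Obj C \<Longrightarrow> Comp D (\<sigma> x) (\<tau> x) = Ident D (fobj F x)"
    "\<And>x. x \<in> Obj C \<Longrightarrow> Comp D (\<tau> x) (\<sigma> x) = Ident D (fobj G x)"
    using nat_iso_inverse[OF assms] by metis
  show thesis
    by (rule that[of \<sigma>])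
      (use \<sigma> in \<open>auto simp: functor_category_def restrict_def fun_eq_iff nat_iso_def\<close>)
qed

lemma isomorphic_functor_category:
  "isomorphic (functor_category C D) F G \<longleftrightarrow> (\<exists>\<tau>. nat_iso C D F G \<tau>)"
proof
  let ?K = "functor_category C D"
  assume "isomorphic ?K F G"
  then obtain \<alpha> where h: "\<alpha> \<in> hom ?K F G" and "is_iso ?K \<alpha>" by (auto simp: isomorphic_def)
  then obtain \<beta> where h': "\<beta> \<in> hom ?K G F" and eq: "Comp ?K \<beta> \<alpha> = Ident ?K F" "Comp ?K \<alpha> \<beta> = Ident ?K G"
    using is_isoE by metis
  obtain \<tau> \<sigma> where \<alpha>: "\<alpha> = Mor F G \<tau>" and \<tau>: "nat_trans C D F G \<tau>"
    and \<beta>: "\<beta> = Mor G F \<sigma>" and \<sigma>: "nat_trans C D G F \<sigma>"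
    using h h' unfolding hom_functor_category by blast
  have "nat_iso C D F G \<tau>"
    unfolding nat_iso_def
  proof (intro conjI \<tau> ballI)
    fix x assume x: "x \<in> Obj C"
    show "is_iso D (\<tau> x)"
    proof (rule is_isoI[OF nat_transD(4)[OF \<tau> x] nat_transD(4)[OF \<sigma> x]])
      show "Comp D (\<sigma> x) (\<tau> x) = Ident D (fobj F x)"
        using fun_cong[OF arg_cong[OF eq(1), of cmp], of x] x by (simp add: \<alpha> \<beta> functor_category_def)
      show "Comp D (\<tau> x) (\<sigma> x) = Ident D (fobj G x)"
        using fun_cong[OF arg_cong[OF eq(2), of cmp], of x] x by (simp add: \<alpha> \<beta> functor_category_def)
    qed
  qed
  then show "\<exists>\<tau>. nat_iso C D F G \<tau>" by blast
next
  let ?K = "functor_category C D"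
  assume "\<exists>\<tau>. nat_iso C D F G \<tau>"
  then obtain \<tau> where \<tau>: "nat_iso C D F G \<tau>" ..
  obtain \<sigma> where \<sigma>: "nat_trans C D G F \<sigma>"
    and inv: "Comp ?K (Mor G F \<sigma>) (Mor F G \<tau>) = Ident ?K F"
      "Comp ?K (Mor F G \<tau>) (Mor G F \<sigma>) = Ident ?K G"
    using nat_iso_inverse_mor[OF \<tau>] .
  have h: "Mor F G \<tau> \<in> hom ?K F G" "Mor G F \<sigma> \<in> hom ?K G F"
    using \<tau> \<sigma> by (auto simp: hom_functor_category nat_iso_def)
  have "is_iso ?K (Mor F G \<tau>)" by (rule is_isoI[OF h inv])
  with h(1) show "isomorphic ?K F G" by (auto simp: isomorphic_def)
qed

lemma hom_full_subcategory:
  "hom (full_subcategory C P) x y = {f \<in> hom C x y. P x \<and> P y}"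
  by (auto simp: hom_def full_subcategory_def)

lemma full_subcategory_simps [simp]:
  "x \<in> Obj (full_subcategory C P) \<longleftrightarrow> x \<in> Obj C \<and> P x"
  "f \<in> Arr (full_subcategory C P) \<longleftrightarrow> f \<in> Arr C \<and> P (Dom C f) \<and> P (Cod C f)"
  "Dom (full_subcategory C P) = Dom C" "Cod (full_subcategory C P) = Cod C"
  "Ident (full_subcategory C P) = Ident C" "Comp (full_subcategory C P) = Comp C"
  by (auto simp: full_subcategory_def)

lemma is_category_full_subcategory:
  assumes C: "is_category C"
  shows "is_category (full_subcategory C P)"
  by (rule is_categoryI)
    (auto simp: hom_full_subcategory arr_obj[OF C] ident_hom[OF C] comp_ident[OF C]
      intro: comp_hom[OF C] comp_assoc[OF C, symmetric])

section \<open>Equivalences\<close>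

lemma equivalence_iff:
  "equivalence C D F \<longleftrightarrow> is_functor C D F \<and> (\<exists>G. is_functor D C G \<and>
     (\<exists>\<eta>. nat_iso C C (comp_functor C G F) (id_functor C) \<eta>) \<and>
     (\<exists>\<eta>. nat_iso D D (comp_functor D F G) (id_functor D) \<eta>))"
  by (simp add: equivalence_def isomorphic_functor_category)

lemma equivalence_trans:
  assumes "equivalence C D F" "equivalence D E H"
  shows "equivalence C E (comp_functor C H F)"
proof -
  obtain G \<eta> \<eta>' where F: "is_functor C D F" and G: "is_functor D C G"
    and \<eta>: "nat_iso C C (comp_functor C G F) (id_functor C) \<eta>"
    and \<eta>': "nat_iso D D (comp_functor D F G) (id_functor D) \<eta>'"
    using assms(1) unfolding equivalence_iff by metis
  obtain K \<theta> \<theta>' where H: "is_functor D E H" and K: "is_functor E D K"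
    and \<theta>: "nat_iso D D (comp_functor D K H) (id_functor D) \<theta>"
    and \<theta>': "nat_iso E E (comp_functor E H K) (id_functor E) \<theta>'"
    using assms(2) unfolding equivalence_iff by metis
  \<comment> \<open>The composite reduces from \<open>G1 K1 H1 F1\<close> to \<open>G1 F1\<close>
    through \<open>\<theta>1\<close>, and then to the identity through \<open>\<eta>1\<close>. The
    fact is stated over fresh types because it is used along \<open>C\<close>, \<open>D\<close>,
    \<open>E\<close> and again along \<open>E\<close>, \<open>D\<close>, \<open>C\<close>.\<close>
  have cancel: "\<exists>\<tau>. nat_iso X X (comp_functor X (comp_functor Z G1 K1) (comp_functor X H1 F1))
      (id_functor X) \<tau>"
    if F1: "is_functor X Y F1" and G1: "is_functor Y X G1"
      and H1: "is_functor Y Z H1" and K1: "is_functor Z Y K1"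
      and \<eta>1: "nat_iso X X (comp_functor X G1 F1) (id_functor X) \<eta>1"
      and \<theta>1: "nat_iso Y Y (comp_functor Y K1 H1) (id_functor Y) \<theta>1"
    for X :: "('x, 'y) category" and Y :: "('z, 'w) category" and Z :: "('v, 't) category"
      and F1 G1 H1 K1 \<eta>1 \<theta>1
  proof -
    have assoc: "comp_functor X (comp_functor Z G1 K1) (comp_functor X H1 F1)
        = comp_functor X G1 (comp_functor X (comp_functor Y K1 H1) F1)"
      by (simp add: comp_functor_assoc[OF is_functor_comp[OF F1 H1]] comp_functor_assoc[OF F1])
    note whisker = nat_iso_whisker_left[OF nat_iso_whisker_right[OF \<theta>1 F1] G1]
    show ?thesis
      unfolding assoc
      using nat_iso_comp[OF whisker[unfolded comp_functor_id_left[OF F1]] \<eta>1] by blast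
  qed
  show ?thesis
    unfolding equivalence_iff
    using is_functor_comp[OF F H] is_functor_comp[OF K G]
      cancel[OF F G H K \<eta> \<theta>] cancel[OF K H G F \<theta>' \<eta>'] by blast
qed

lemma equivalence_inverse:
  assumes "equivalence C D F"
  obtains G \<eta> \<epsilon> where "equivalence D C G"
    "nat_iso C C (comp_functor C G F) (id_functor C) \<eta>"
    "nat_iso D D (comp_functor D F G) (id_functor D) \<epsilon>"
  using assms unfolding equivalence_iff by metis

text \<open>Strictly inverse functors compose to the identity records, so identity transformations
  suffice. This serves the comparison of sets with sheaves on a point.\<close>

lemma inverse_functors_equivalence:
  assumes F: "is_functor C D F" and G: "is_functor D C G"
    and "\<And>x. x \<in> Obj C \<Longrightarrow> fobj G (fobj F x) = x" "\<And>f. f \<in> Arr C \<Longrightarrow> farr G (farr F f) = f"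
    and "\<And>x. x \<in> Obj D \<Longrightarrow> fobj F (fobj G x) = x" "\<And>f. f \<in> Arr D \<Longrightarrow> farr F (farr G f) = f"
  shows "equivalence C D F"
proof -
  note C = is_functor_dom[OF F] and D = is_functor_cod[OF F]
  have "comp_functor C G F = id_functor C"
    by (rule func_eqI[OF is_functor_comp[OF F G] is_functor_id[OF C]]) (simp_all add: assms)
  moreover have "comp_functor D F G = id_functor D"
    by (rule func_eqI[OF is_functor_comp[OF G F] is_functor_id[OF D]]) (simp_all add: assms)
  ultimately show ?thesis
    unfolding equivalence_iff
    using F G nat_iso_refl[OF is_functor_id[OF C]] nat_iso_refl[OF is_functor_id[OF D]] by metis
qed

text \<open>Naturality of \<open>\<eta>\<close> makes \<open>f\<close> composed with
  \<open>\<eta> x\<close> depend only on \<open>farr F f\<close>, and the invertible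
  \<open>\<eta> x\<close> can then be cancelled.\<close>

lemma equivalence_faithful:
  assumes "equivalence C D F" and f: "f \<in> hom C x y" and g: "g \<in> hom C x y"
    and eq: "farr F f = farr F g"
  shows "f = g"
proof -
  obtain G \<eta> where F: "is_functor C D F"
    and \<eta>: "nat_iso C C (comp_functor C G F) (id_functor C) \<eta>"
    using assms(1) unfolding equivalence_iff by metis
  note C = is_functor_dom[OF F]
  have nt: "nat_trans C C (comp_functor C G F) (id_functor C) \<eta>" and x: "x \<in> Obj C"
    and iso: "is_iso C (\<eta> x)"
    using \<eta> hom_objD[OF C f] by (auto simp: nat_iso_def)
  have \<eta>x: "\<eta> x \<in> hom C (fobj (comp_functor C G F) x) x" using nat_transD(4)[OF nt x] x by simp
  have "Comp C f (\<eta> x) = Comp C g (\<eta> x)"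
    using nat_transD(5)[OF nt f] nat_transD(5)[OF nt g] eq hom_arrD[OF f] hom_arrD[OF g] by simp
  then show ?thesis using iso_cancel_right[OF C \<eta>x iso f g] by blast
qed

text \<open>The preimage is the conjugate of \<open>farr G g\<close> by the components of
  \<open>\<eta>\<close> at \<open>x\<close> and \<open>y\<close>; naturality shows that its image
  under \<open>F\<close> and \<open>g\<close> agree after applying \<open>G\<close>.\<close>

lemma equivalence_full:
  assumes "equivalence C D F" and x: "x \<in> Obj C" and y: "y \<in> Obj C"
    and g: "g \<in> hom D (fobj F x) (fobj F y)"
  obtains f where "f \<in> hom C x y" "farr F f = g"
proof -
  have F: "is_functor C D F" using assms(1) by (simp add: equivalence_def)
  note C = is_functor_dom[OF F]
  obtain G \<eta> where G: "equivalence D C G"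
    and \<eta>: "nat_iso C C (comp_functor C G F) (id_functor C) \<eta>"
    using equivalence_inverse[OF assms(1)] by metis
  have G': "is_functor D C G" using G by (simp add: equivalence_def)
  have nt: "nat_trans C C (comp_functor C G F) (id_functor C) \<eta>"
    and iso: "is_iso C (\<eta> x)" "is_iso C (\<eta> y)"
    using \<eta> x y by (auto simp: nat_iso_def)
  have \<eta>x: "\<eta> x \<in> hom C (fobj G (fobj F x)) x" and \<eta>y: "\<eta> y \<in> hom C (fobj G (fobj F y)) y"
    using nat_transD(4)[OF nt x] nat_transD(4)[OF nt y] x y by auto
  obtain k where k: "k \<in> hom C x (fobj G (fobj F x))" "Comp C k (\<eta> x) = Ident C (fobj G (fobj F x))"
    using is_isoE[OF \<eta>x iso(1)] .
  note Gg = functor_hom[OF G' g]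
  note c = comp_hom[OF C Gg \<eta>y]
  define f where "f = Comp C (Comp C (\<eta> y) (farr G g)) k"
  have f: "f \<in> hom C x y" unfolding f_def by (rule comp_hom[OF C k(1) c])
  have "Comp C (\<eta> y) (farr G (farr F f)) = Comp C f (\<eta> x)"
    using nat_transD(5)[OF nt f] hom_arrD[OF f] by simp
  also have "\<dots> = Comp C (\<eta> y) (farr G g)"
    unfolding f_def using comp_assoc[OF C \<eta>x k(1) c] comp_ident[OF C c] k(2) by simp
  finally have "farr G (farr F f) = farr G g"
    using iso_cancel_left[OF C \<eta>y iso(2) functor_hom[OF G' functor_hom[OF F f]] Gg] by blast
  \<comment> \<open>The pseudo-inverse \<open>G\<close> is an equivalence in its own right, hence
    faithful; this stands in for a triangle identity.\<close>
  then have "farr F f = g"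
    using equivalence_faithful[OF G functor_hom[OF F f] g] by blast
  with f that show thesis by blast
qed

lemma equivalence_essentially_surjective:
  assumes "equivalence C D F" and y: "y \<in> Obj D"
  obtains x h where "x \<in> Obj C" "h \<in> hom D (fobj F x) y" "is_iso D h"
proof -
  obtain G \<epsilon> where G: "is_functor D C G" and \<epsilon>: "nat_iso D D (comp_functor D F G) (id_functor D) \<epsilon>"
    using assms(1) unfolding equivalence_iff by metis
  have "\<epsilon> y \<in> hom D (fobj F (fobj G y)) y" "is_iso D (\<epsilon> y)"
    using \<epsilon> nat_transD(4)[of D D "comp_functor D F G" "id_functor D" \<epsilon> y] y
    by (auto simp: nat_iso_def)
  then show thesis using that functor_obj[OF G y] by blast
qed

section \<open>Equivalences preserve limits and colimits\<close>

lemma op_category_simps [simp]: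
  "Obj (op_category C) = Obj C" "Arr (op_category C) = Arr C"
  "Dom (op_category C) = Cod C" "Cod (op_category C) = Dom C"
  "Ident (op_category C) = Ident C" "Comp (op_category C) g f = Comp C f g"
  by (simp_all add: op_category_def)

lemma hom_op_category [simp]: "hom (op_category C) x y = hom C y x"
  by (auto simp: hom_def)

lemma op_op_category [simp]:
  fixes C :: "('o, 'a) category"
  shows "op_category (op_category C) = C"
  by (simp add: op_category_def)

lemma is_category_op: "is_category C \<Longrightarrow> is_category (op_category C)"
  by (rule is_categoryI) (auto simp: arr_obj ident_hom comp_ident intro: comp_hom comp_assoc)

text \<open>A functor record has no variance built in, so the same record serves between the
  opposite categories. This is what allows cocones to be handled as cones without converting
  diagrams.\<close>

lemma is_functor_op:
  assumes "is_functor C D F"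
  shows "is_functor (op_category C) (op_category D) F"
  by (rule is_functorI)
    (use assms functor_comp[OF assms] in \<open>auto simp: is_functor_def PiE_def
      intro: is_category_op is_functor_dom is_functor_cod functor_obj functor_hom functor_ident\<close>)

lemma nat_iso_op:
  assumes "nat_iso C D F G \<tau>"
  shows "nat_iso (op_category C) (op_category D) G F \<tau>"
proof -
  have nt: "nat_trans C D F G \<tau>" and iso: "\<And>x. x \<in> Obj C \<Longrightarrow> is_iso D (\<tau> x)"
    using assms by (auto simp: nat_iso_def)
  have "is_iso (op_category D) (\<tau> x)" if "x \<in> Obj C" for x
    using iso[OF that] by (auto simp: is_iso_def)
  then show ?thesis
    using nt unfolding nat_iso_def
    by (auto intro!: nat_transI is_functor_op nat_transD(1,2)[OF nt] nat_transD(4)[OF nt]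
        simp: nat_transD(3)[OF nt] nat_transD(5)[OF nt])
qed

lemma comp_functor_op [simp]: "comp_functor (op_category C) = comp_functor C"
  by (auto simp: comp_functor_def fun_eq_iff)

lemma id_functor_op [simp]: "id_functor (op_category C) = id_functor C"
  by (simp add: id_functor_def)

lemma equivalence_op:
  assumes "equivalence C D F"
  shows "equivalence (op_category C) (op_category D) F"
proof -
  obtain G \<eta> \<epsilon> where F: "is_functor C D F" and G: "is_functor D C G"
    and \<eta>: "nat_iso C C (comp_functor C G F) (id_functor C) \<eta>"
    and \<epsilon>: "nat_iso D D (comp_functor D F G) (id_functor D) \<epsilon>"
    using assms unfolding equivalence_iff by metis
  \<comment> \<open>Opposition reverses natural isomorphisms, while an equivalence wants them to end
    at the identity. Hence the inverses are the ones to be opposed.\<close>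
  obtain \<eta>' \<epsilon>' where "nat_iso C C (id_functor C) (comp_functor C G F) \<eta>'"
    "nat_iso D D (id_functor D) (comp_functor D F G) \<epsilon>'"
    using nat_iso_inverse[OF \<eta>] nat_iso_inverse[OF \<epsilon>] by metis
  from nat_iso_op[OF this(1)] nat_iso_op[OF this(2)] show ?thesis
    unfolding equivalence_iff using is_functor_op[OF F] is_functor_op[OF G] by auto
qed

text \<open>Each cone over the image diagram is transported to one over \<open>X\<close> itself:
  essential surjectivity supplies the apex, fullness the legs, faithfulness their compatibility. The
  universal property of \<open>c\<close> applies there, and the factorization is carried back along
  the isomorphism of apexes.\<close>

lemma equivalence_preserves_limit_cone:
  assumes eq: "equivalence C D F" and lim: "is_limit_cone I C X c"
  shows "is_limit_cone I D (comp_functor I F X) (map_cone F c)"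
proof -
  have F: "is_functor C D F" using eq by (simp add: equivalence_def)
  note C = is_functor_dom[OF F] and D = is_functor_cod[OF F]
  have cone: "is_cone I C X c" using lim by (simp add: is_limit_cone_def)
  then have X: "is_functor I C X" and apex: "apex c \<in> Obj C"
    and leg: "\<And>i. i \<in> Obj I \<Longrightarrow> leg c i \<in> hom C (apex c) (fobj X i)"
    and legeq: "\<And>k. k \<in> Arr I \<Longrightarrow> Comp C (farr X k) (leg c (Dom I k)) = leg c (Cod I k)"
    by (auto simp: is_cone_def)
  note I = is_functor_dom[OF X]
  have Xk: "farr X k \<in> hom C (fobj X (Dom I k)) (fobj X (Cod I k))" if "k \<in> Arr I" for k
    using functor_hom[OF X arr_hom[OF that]] .
  let ?X = "comp_functor I F X"
  have cone': "is_cone I D ?X (map_cone F c)"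
    unfolding is_cone_def map_cone_def
    using is_functor_comp[OF X F] functor_obj[OF F apex] functor_hom[OF F leg]
      functor_comp[OF F leg Xk] legeq arr_obj[OF I] by auto
  have "\<exists>!u. u \<in> hom D (apex d) (fobj F (apex c)) \<and>
      (\<forall>i\<in>Obj I. Comp D (farr F (leg c i)) u = leg d i)" if d: "is_cone I D ?X d" for d
  proof -
    have dapex: "apex d \<in> Obj D"
      and dleg: "\<And>i. i \<in> Obj I \<Longrightarrow> leg d i \<in> hom D (apex d) (fobj F (fobj X i))"
      and dlegeq: "\<And>k. k \<in> Arr I \<Longrightarrow> Comp D (farr F (farr X k)) (leg d (Dom I k)) = leg d (Cod I k)"
      using d by (auto simp: is_cone_def)
    obtain x h where x: "x \<in> Obj C" and h: "h \<in> hom D (fobj F x) (apex d)" and iso: "is_iso D h"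
      using equivalence_essentially_surjective[OF eq dapex] .
    obtain k where k: "k \<in> hom D (apex d) (fobj F x)" and kh: "Comp D k h = Ident D (fobj F x)"
      and hk: "Comp D h k = Ident D (apex d)"
      using is_isoE[OF h iso] .
    \<comment> \<open>Fullness only concerns arrows between values of \<open>F\<close>, so each leg
      is first composed with \<open>h\<close> to start at \<open>fobj F x\<close>.\<close>
    have "\<exists>l. l \<in> hom C x (fobj X i) \<and> farr F l = Comp D (leg d i) h" if i: "i \<in> Obj I" for i
      using equivalence_full[OF eq x functor_obj[OF X i] comp_hom[OF D h dleg[OF i]]] by metis
    then obtain l where l: "\<And>i. i \<in> Obj I \<Longrightarrow> l i \<in> hom C x (fobj X i)"
      and Fl: "\<And>i. i \<in> Obj I \<Longrightarrow> farr F (l i) = Comp D (leg d i) h"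
      by metis
    have "Comp C (farr X a) (l (Dom I a)) = l (Cod I a)" if a: "a \<in> Arr I" for a
    proof (rule equivalence_faithful[OF eq comp_hom[OF C l Xk[OF a]] l])
      note i = arr_obj(1)[OF I a] and j = arr_obj(2)[OF I a]
      show "Dom I a \<in> Obj I" "Cod I a \<in> Obj I" by fact+
      show "farr F (Comp C (farr X a) (l (Dom I a))) = farr F (l (Cod I a))"
        using functor_comp[OF F l[OF i] Xk[OF a]] Fl[OF i] Fl[OF j]
          comp_assoc[OF D h dleg[OF i] functor_hom[OF F Xk[OF a]]] dlegeq[OF a] by simp
    qed
    then have "is_cone I C X \<lparr>apex = x, leg = l\<rparr>" by (simp add: is_cone_def X x l)
    then have ex1: "\<exists>!u. u \<in> hom C x (apex c) \<and> (\<forall>i\<in>Obj I. Comp C (leg c i) u = l i)"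
      using lim[unfolded is_limit_cone_def, THEN conjunct2, rule_format, of "\<lparr>apex = x, leg = l\<rparr>"]
      by simp
    then obtain u where u: "u \<in> hom C x (apex c)"
      and lu: "\<And>i. i \<in> Obj I \<Longrightarrow> Comp C (leg c i) u = l i" by blast
    note Fu = functor_hom[OF F u]
    show ?thesis
    proof (rule ex1I[of _ "Comp D (farr F u) k"], intro conjI ballI)
      show "Comp D (farr F u) k \<in> hom D (apex d) (fobj F (apex c))"
        by (rule comp_hom[OF D k Fu])
      fix i assume i: "i \<in> Obj I"
      have "Comp D (farr F (leg c i)) (Comp D (farr F u) k) = Comp D (Comp D (leg d i) h) k"
        using comp_assoc[OF D k Fu functor_hom[OF F leg[OF i]]] functor_comp[OF F u leg[OF i]]
          lu[OF i] Fl[OF i] by simp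
      also have "\<dots> = leg d i"
        using comp_assoc[OF D k h dleg[OF i]] hk comp_ident[OF D dleg[OF i]] by simp
      finally show "Comp D (farr F (leg c i)) (Comp D (farr F u) k) = leg d i" .
    next
      fix v assume "v \<in> hom D (apex d) (fobj F (apex c)) \<and>
        (\<forall>i\<in>Obj I. Comp D (farr F (leg c i)) v = leg d i)"
      then have v: "v \<in> hom D (apex d) (fobj F (apex c))"
        and lv: "\<And>i. i \<in> Obj I \<Longrightarrow> Comp D (farr F (leg c i)) v = leg d i" by auto
      \<comment> \<open>A competing factorization \<open>v\<close> is lifted in the same way;
        faithfulness shows that \<open>w\<close> factors the lifted cone, so it is
        \<open>u\<close>.\<close>
      obtain w where w: "w \<in> hom C x (apex c)" and Fw: "farr F w = Comp D v h"
        using equivalence_full[OF eq x apex comp_hom[OF D h v]] .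
      have "Comp C (leg c i) w = l i" if i: "i \<in> Obj I" for i
        by (rule equivalence_faithful[OF eq comp_hom[OF C w leg[OF i]] l[OF i]])
          (use functor_comp[OF F w leg[OF i]] Fw Fl[OF i] lv[OF i]
            comp_assoc[OF D h v functor_hom[OF F leg[OF i]]] in simp)
      then have "w = u" using ex1 u lu w by blast
      then show "v = Comp D (farr F u) k"
        using Fw comp_assoc[OF D k h v] hk comp_ident[OF D v] by simp
    qed
  qed
  then show ?thesis
    using cone' unfolding is_limit_cone_def by (simp add: map_cone_def)
qed

text \<open>A colimit cocone is a limit cone in the opposite category, and an equivalence remains
  one between opposites. Neither directedness nor smallness of the shape enters.\<close>

lemma equivalence_preserves_directed_colimits:
  "equivalence C D F \<Longrightarrow> preserves_directed_colimits U C D F"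
  unfolding preserves_directed_colimits_def is_colimit_cocone_def
  using equivalence_preserves_limit_cone[OF equivalence_op] by (metis comp_functor_op)

text \<open>Legs are total functions with no constraint off \<open>Obj I\<close>. There, mapping a
  cone along a restricted composite may differ from mapping it twice, so cones have to be compared
  up to this ambiguity.\<close>

lemma is_cone_cong:
  assumes "apex c = apex c'" "\<And>i. i \<in> Obj I \<Longrightarrow> leg c i = leg c' i"
  shows "is_cone I C X c \<longleftrightarrow> is_cone I C X c'"
  unfolding is_cone_def using assms arr_obj is_functor_dom by (metis (no_types))

lemma is_limit_cone_cong:
  assumes "apex c = apex c'" "\<And>i. i \<in> Obj I \<Longrightarrow> leg c i = leg c' i"
  shows "is_limit_cone I C X c \<longleftrightarrow> is_limit_cone I C X c'"
  unfolding is_limit_cone_def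
  by (simp add: is_cone_cong[where I = I and C = C and X = X, OF assms] assms)

lemma preserves_directed_colimits_comp:
  fixes U :: "'u itself"
  assumes F: "preserves_directed_colimits U A B F" and H: "preserves_directed_colimits U B D H"
  shows "preserves_directed_colimits U A D (comp_functor A H F)"
  unfolding preserves_directed_colimits_def
proof (intro allI impI)
  fix P :: "'u set" and r X c
  let ?P = "poset_category P r"
  assume *: "small P \<and> directed_poset P r \<and> is_colimit_cocone ?P A X c"
  then have col: "is_cone (op_category ?P) (op_category A) X c"
    by (simp add: is_colimit_cocone_def is_limit_cone_def)
  \<comment> \<open>The cocone presents the diagram between opposite categories; opposing once more
    recovers it as a functor into \<open>A\<close>, as reassociating the composite requires.\<close>
  then have X: "is_functor ?P A X"
    using is_functor_op[of "op_category ?P" "op_category A" X] by (simp add: is_cone_def)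
  have "leg c i \<in> Arr A" if "i \<in> Obj ?P" for i
    using col that by (auto simp: is_cone_def hom_def)
  then have legs: "\<And>i. i \<in> Obj (op_category ?P) \<Longrightarrow>
      leg (map_cone (comp_functor A H F) c) i = leg (map_cone H (map_cone F c)) i"
    by (simp add: map_cone_def)
  have apex: "apex (map_cone (comp_functor A H F) c) = apex (map_cone H (map_cone F c))"
    using col by (simp add: map_cone_def is_cone_def)
  have "is_colimit_cocone ?P D (comp_functor ?P H (comp_functor ?P F X)) (map_cone H (map_cone F c))"
    using F H * unfolding preserves_directed_colimits_def by blast
  then show "is_colimit_cocone ?P D (comp_functor ?P (comp_functor A H F) X)
      (map_cone (comp_functor A H F) c)"
    unfolding is_colimit_cocone_def comp_functor_assoc[OF X] using is_limit_cone_cong[OF apex legs]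
    by blast
qed

section \<open>Precomposition\<close>

lemma hom_acc_category:
  "hom (acc_category U A B) F G = {Mor F G \<tau> | \<tau>. nat_trans A B F G \<tau> \<and>
    preserves_directed_colimits U A B F \<and> preserves_directed_colimits U A B G}"
  by (auto simp: acc_category_def hom_full_subcategory hom_functor_category)

lemma acc_category_simps:
  "F \<in> Obj (acc_category U A B) \<longleftrightarrow> is_functor A B F \<and> preserves_directed_colimits U A B F"
  "Ident (acc_category U A B) F = Mor F F (\<lambda>x\<in>Obj A. Ident B (fobj F x))"
  "Comp (acc_category U A B) \<beta> \<alpha> =
    Mor (src \<alpha>) (tgt \<beta>) (\<lambda>x\<in>Obj A. Comp B (cmp \<beta> x) (cmp \<alpha> x))"
  by (simp_all add: acc_category_def functor_category_def)

lemma is_category_acc_category: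
  "is_category A \<Longrightarrow> is_category B \<Longrightarrow> is_category (acc_category U A B)"
  unfolding acc_category_def by (intro is_category_full_subcategory is_category_functor_category)

text \<open>For \<open>D\<close> the category of sets this is the inverse image of the geometric
  morphism that the Scott construction assigns to \<open>F\<close>, which explains the reversed
  direction.\<close>

definition precompose :: "'u itself \<Rightarrow> ('o, 'a) category \<Rightarrow> ('p, 'b) category \<Rightarrow> ('q, 'c) category \<Rightarrow>
    ('o, 'a, 'p, 'b) func \<Rightarrow>
    (('p, 'b, 'q, 'c) func, (('p, 'b, 'q, 'c) func, 'p \<Rightarrow> 'c) mor,
     ('o, 'a, 'q, 'c) func, (('o, 'a, 'q, 'c) func, 'o \<Rightarrow> 'c) mor) func" where
  "precompose U A B D F = \<lparr>fobj = (\<lambda>H\<in>Obj (acc_category U B D). comp_functor A H F),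
     farr = (\<lambda>\<alpha>\<in>Arr (acc_category U B D). Mor (comp_functor A (src \<alpha>) F) (comp_functor A (tgt \<alpha>) F)
       (\<lambda>x\<in>Obj A. cmp \<alpha> (fobj F x)))\<rparr>"

lemma precompose_obj:
  "H \<in> Obj (acc_category U B D) \<Longrightarrow> fobj (precompose U A B D F) H = comp_functor A H F"
  by (simp add: precompose_def)

lemma precompose_arr:
  "Mor H K \<tau> \<in> hom (acc_category U B D) H K \<Longrightarrow> farr (precompose U A B D F) (Mor H K \<tau>) =
    Mor (comp_functor A H F) (comp_functor A K F) (\<lambda>x\<in>Obj A. \<tau> (fobj F x))"
  using hom_arrD(1) by (fastforce simp: precompose_def)

lemma is_functor_precompose:
  assumes F: "is_functor A B F" and pF: "preserves_directed_colimits U A B F" and D: "is_category D"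
  shows "is_functor (acc_category U B D) (acc_category U A D) (precompose U A B D F)"
proof (rule is_functorI)
  note A = is_functor_dom[OF F] and B = is_functor_cod[OF F]
  let ?P = "precompose U A B D F"
  show cat: "is_category (acc_category U B D)" "is_category (acc_category U A D)"
    by (intro is_category_acc_category A B D)+
  show "fobj ?P \<in> extensional (Obj (acc_category U B D))"
    "farr ?P \<in> extensional (Arr (acc_category U B D))"
    by (simp_all add: precompose_def)
  show "fobj ?P H \<in> Obj (acc_category U A D)" if "H \<in> Obj (acc_category U B D)" for H
    using that by (auto simp: precompose_obj acc_category_simps(1)
        intro: preserves_directed_colimits_comp[OF pF] is_functor_comp[OF F])
  show "farr ?P \<alpha> \<in> hom (acc_category U A D) (fobj ?P H) (fobj ?P K)"
    if \<alpha>: "\<alpha> \<in> hom (acc_category U B D) H K" for \<alpha> H K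
  proof -
    obtain \<tau> where \<tau>: "\<alpha> = Mor H K \<tau>" and "nat_trans B D H K \<tau>"
      and "preserves_directed_colimits U B D H" "preserves_directed_colimits U B D K"
      using \<alpha> unfolding hom_acc_category by blast
    moreover have "farr ?P \<alpha> = Mor (comp_functor A H F) (comp_functor A K F) (\<lambda>x\<in>Obj A. \<tau> (fobj F x))"
      using precompose_arr \<alpha> \<tau> by metis
    ultimately show ?thesis
      using hom_objD[OF cat(1) \<alpha>]
      by (auto simp: precompose_obj hom_acc_category
          intro: nat_trans_whisker_right[OF _ F] preserves_directed_colimits_comp[OF pF])
  qed
  show "farr ?P (Ident (acc_category U B D) H) = Ident (acc_category U A D) (fobj ?P H)"
    if H: "H \<in> Obj (acc_category U B D)" for H
    unfolding acc_category_simps(2) precompose_obj[OF H]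
      precompose_arr[OF ident_hom[OF cat(1) H, unfolded acc_category_simps(2)]]
    using functor_obj[OF F] by (auto simp: restrict_def fun_eq_iff)
  show "farr ?P (Comp (acc_category U B D) \<beta> \<alpha>) = Comp (acc_category U A D) (farr ?P \<beta>) (farr ?P \<alpha>)"
    if \<alpha>: "\<alpha> \<in> hom (acc_category U B D) H K" and \<beta>: "\<beta> \<in> hom (acc_category U B D) K L" for \<alpha> \<beta> H K L
  proof -
    obtain \<sigma> \<tau> where \<sigma>: "\<alpha> = Mor H K \<sigma>" and \<tau>: "\<beta> = Mor K L \<tau>"
      using \<alpha> \<beta> unfolding hom_acc_category by blast
    show ?thesis
      unfolding \<sigma> \<tau> acc_category_simps(3) mor.sel
        precompose_arr[OF \<alpha>[unfolded \<sigma>]] precompose_arr[OF \<beta>[unfolded \<tau>]]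
        precompose_arr[OF comp_hom[OF cat(1) \<alpha> \<beta>, unfolded acc_category_simps \<sigma> \<tau> mor.sel]]
      using functor_obj[OF F] by (auto simp: restrict_def fun_eq_iff)
  qed
qed

text \<open>The component at \<open>H\<close> is \<open>\<eta>\<close> whiskered by
  \<open>H\<close>, an isomorphism from \<open>H G F\<close> to \<open>H\<close>. Hence
  \<open>\<eta>\<close>, which contracts \<open>G F\<close> on \<open>A\<close>, contracts the
  composite of the precompositions on \<open>acc_category U A D\<close>.\<close>

lemma precompose_nat_iso:
  assumes F: "is_functor A B F" "preserves_directed_colimits U A B F"
    and G: "is_functor B A G" "preserves_directed_colimits U B A G"
    and \<eta>: "nat_iso A A (comp_functor A G F) (id_functor A) \<eta>" and D: "is_category D"
  shows "\<exists>\<tau>. nat_iso (acc_category U A D) (acc_category U A D)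
    (comp_functor (acc_category U A D) (precompose U A B D F) (precompose U B A D G))
    (id_functor (acc_category U A D)) \<tau>"
proof -
  let ?S = "acc_category U A D"
  let ?R = "comp_functor ?S (precompose U A B D F) (precompose U B A D G)"
  let ?t = "\<lambda>H. \<lambda>x\<in>Obj A. farr H (\<eta> x)"
  let ?\<tau> = "\<lambda>H\<in>Obj ?S. Mor (fobj ?R H) H (?t H)"
  note PF = is_functor_precompose[OF F D] and PG = is_functor_precompose[OF G D]
  note R = is_functor_comp[OF PG PF]
  note A = is_functor_dom[OF F(1)]
  note S = is_functor_dom[OF R]
  have nt: "nat_trans A A (comp_functor A G F) (id_functor A) \<eta>" using \<eta> by (simp add: nat_iso_def)
  have Robj: "fobj ?R H = comp_functor A H (comp_functor A G F)" if "H \<in> Obj ?S" for H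
    using that functor_obj[OF PG that] by (simp add: precompose_obj comp_functor_assoc[OF F(1)])
  have comp: "nat_iso A D (fobj ?R H) H (?t H)" if H: "H \<in> Obj ?S" for H
  proof -
    have H': "is_functor A D H" using H by (simp add: acc_category_simps(1))
    show ?thesis
      using nat_iso_whisker_left[OF \<eta> H'] unfolding Robj[OF H] comp_functor_id_right[OF H'] .
  qed
  have hom: "?\<tau> H \<in> hom ?S (fobj ?R H) H" if H: "H \<in> Obj ?S" for H
    using comp[OF H] H functor_obj[OF R H] by (auto simp: hom_acc_category acc_category_simps(1) nat_iso_def)
  have "nat_iso ?S ?S ?R (id_functor ?S) ?\<tau>"
    unfolding nat_iso_def
  proof (intro conjI ballI nat_transI R is_functor_id S)
    fix H assume H: "H \<in> Obj ?S"
    show "?\<tau> H \<in> hom ?S (fobj ?R H) (fobj (id_functor ?S) H)" using hom[OF H] H by simp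
    obtain \<sigma> where \<sigma>: "nat_trans A D H (fobj ?R H) \<sigma>"
      and inv: "Comp (functor_category A D) (Mor H (fobj ?R H) \<sigma>) (Mor (fobj ?R H) H (?t H))
          = Ident (functor_category A D) (fobj ?R H)"
        "Comp (functor_category A D) (Mor (fobj ?R H) H (?t H)) (Mor H (fobj ?R H) \<sigma>)
          = Ident (functor_category A D) H"
      using nat_iso_inverse_mor[OF comp[OF H]] .
    \<comment> \<open>The inverse taken in the functor category already lies in \<open>?S\<close>,
      because this subcategory is full.\<close>
    show "is_iso ?S (?\<tau> H)"
    proof (rule is_isoI[OF hom[OF H]])
      show "Mor H (fobj ?R H) \<sigma> \<in> hom ?S H (fobj ?R H)"
        using \<sigma> H functor_obj[OF R H] by (auto simp: hom_acc_category acc_category_simps(1))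
    qed (use inv H in \<open>simp_all add: acc_category_def\<close>)
  next
    fix \<alpha> H K assume \<alpha>: "\<alpha> \<in> hom ?S H K"
    then obtain \<rho> where \<rho>: "\<alpha> = Mor H K \<rho>" and \<rho>nt: "nat_trans A D H K \<rho>"
      unfolding hom_acc_category by blast
    note H = hom_objD(1)[OF S \<alpha>] and K = hom_objD(2)[OF S \<alpha>]
    have G\<alpha>: "farr (precompose U B A D G) \<alpha>
        = Mor (comp_functor B H G) (comp_functor B K G) (\<lambda>y\<in>Obj B. \<rho> (fobj G y))"
      using precompose_arr[OF \<alpha>[unfolded \<rho>]] \<rho> by simp
    have R\<alpha>: "farr ?R \<alpha> = Mor (fobj ?R H) (fobj ?R K) (\<lambda>x\<in>Obj A. \<rho> (fobj G (fobj F x)))"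
    proof -
      have "Mor (comp_functor B H G) (comp_functor B K G) (\<lambda>y\<in>Obj B. \<rho> (fobj G y))
          \<in> hom (acc_category U B D) (comp_functor B H G) (comp_functor B K G)"
        using functor_hom[OF PG \<alpha>] G\<alpha> H K by (simp add: precompose_obj)
      from precompose_arr[OF this, of A F] show ?thesis
        using hom_arrD(1)[OF \<alpha>] H K functor_obj[OF PG H] functor_obj[OF PG K] functor_obj[OF F(1)]
        by (auto simp: G\<alpha> precompose_obj restrict_def fun_eq_iff)
    qed
    \<comment> \<open>Naturality of \<open>?\<tau>\<close> in \<open>\<alpha>\<close> amounts to
      naturality of \<open>\<rho>\<close> itself, applied to the arrow
      \<open>\<eta> x\<close>.\<close>
    have nat: "Comp D (farr K (\<eta> x)) (\<rho> (fobj G (fobj F x))) = Comp D (\<rho> x) (farr H (\<eta> x))"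
      if x: "x \<in> Obj A" for x
      using nat_transD(5)[OF \<rho>nt nat_transD(4)[OF nt x]] x by simp
    show "Comp ?S (?\<tau> K) (farr ?R \<alpha>) = Comp ?S (farr (id_functor ?S) \<alpha>) (?\<tau> H)"
      using H K hom_arrD(1)[OF \<alpha>] nat
      by (auto simp: R\<alpha>[unfolded \<rho>] \<rho> acc_category_simps(3) restrict_def fun_eq_iff
          simp del: comp_functor_simps)
  qed simp
  then show ?thesis by blast
qed

text \<open>Precomposition with \<open>G\<close> is the pseudo-inverse. By contravariance the two
  isomorphisms trade places: \<open>\<epsilon>\<close> contracts the composite on the source
  \<open>acc_category U B D\<close>, and \<open>\<eta>\<close> the one on the target.\<close>

lemma equivalence_precompose:
  assumes "equivalence A B F" and D: "is_category D"
  shows "equivalence (acc_category U B D) (acc_category U A D) (precompose U A B D F)"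
proof -
  obtain G \<eta> \<epsilon> where eqG: "equivalence B A G"
    and \<eta>: "nat_iso A A (comp_functor A G F) (id_functor A) \<eta>"
    and \<epsilon>: "nat_iso B B (comp_functor B F G) (id_functor B) \<epsilon>"
    using equivalence_inverse[OF assms(1)] .
  have F: "is_functor A B F" and G: "is_functor B A G"
    using assms(1) eqG by (auto simp: equivalence_def)
  note pF = equivalence_preserves_directed_colimits[OF assms(1), of U]
    and pG = equivalence_preserves_directed_colimits[OF eqG, of U]
  show ?thesis
    unfolding equivalence_iff
    using is_functor_precompose[OF F pF D] is_functor_precompose[OF G pG D]
      precompose_nat_iso[OF F pF G pG \<eta> D] precompose_nat_iso[OF G pG F pF \<epsilon> D] by blast
qed

section \<open>The category of sets is a topos\<close>

lemma hom_set_category: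
  "hom set_category A B = {Mor A B f | f. small A \<and> small B \<and> f \<in> A \<rightarrow>\<^sub>E B}"
  by (auto simp: hom_def set_category_def)

lemma is_category_set_category: "is_category set_category"
proof (rule is_categoryI)
  fix A B C f g assume "f \<in> hom set_category A B" "g \<in> hom set_category B C"
  then show "Comp set_category g f \<in> hom set_category A C"
    by (auto simp: hom_set_category) (auto simp: set_category_def)
next
  fix A B f assume "f \<in> hom set_category A B"
  then show "Comp set_category f (Ident set_category A) = f"
    "Comp set_category (Ident set_category B) f = f"
    by (auto simp: hom_set_category)
      (auto simp: set_category_def fun_eq_iff PiE_def extensional_def)
next
  fix A B C D f g h
  assume "f \<in> hom set_category A B" "g \<in> hom set_category B C" "h \<in> hom set_category C D"
  then show "Comp set_category h (Comp set_category g f) = Comp set_category (Comp set_category h g) f"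
    by (auto simp: hom_set_category) (auto simp: set_category_def fun_eq_iff)
qed (auto simp: hom_set_category, auto simp: set_category_def)

text \<open>The terminal category, with one element of the universe type as both object and arrow,
  since a site for \<open>topos\<close> must have both carried by that type.\<close>

definition point_category :: "'u \<Rightarrow> ('u, 'u) category" where
  "point_category a = \<lparr>Obj = {a}, Arr = {a}, Dom = (\<lambda>_. a), Cod = (\<lambda>_. a), Ident = (\<lambda>_. a),
     Comp = (\<lambda>_ _. a)\<rparr>"

lemma point_category_simps [simp]:
  "Obj (point_category a) = {a}" "Arr (point_category a) = {a}"
  "Dom (point_category a) f = a" "Cod (point_category a) f = a"
  "Ident (point_category a) x = a" "Comp (point_category a) g f = a"
  by (simp_all add: point_category_def)

lemma is_category_point_category: "is_category (point_category a)"
  by (simp add: is_category_def hom_def)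

lemma op_point_category [simp]: "op_category (point_category a) = point_category a"
  by (simp add: op_category_def point_category_def)

lemma grothendieck_topology_point: "grothendieck_topology (point_category a) (\<lambda>_. {{a}})"
  by (auto simp: grothendieck_topology_def is_sieve_def pullback_sieve_def)

text \<open>The only cover is the maximal sieve, generated by the identity. A matching family is
  then its value at \<open>a\<close>, which is also its unique amalgamation because
  \<open>farr F a\<close> acts as the identity.\<close>

lemma is_sheaf_point:
  "is_sheaf (point_category a) (\<lambda>_. {{a}}) F \<longleftrightarrow> is_functor (point_category a) set_category F"
proof
  assume F: "is_functor (point_category a) set_category F"
  have "farr F a = Ident set_category (fobj F a)"
    using functor_ident[OF F, of a] by simp
  then have id: "cmp (farr F a) y = y" if "y \<in> fobj F a" for y
    using that by (simp add: set_category_def)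
  then show "is_sheaf (point_category a) (\<lambda>_. {{a}}) F"
    using F by (auto simp: is_sheaf_def intro!: ex1I)
qed (simp add: is_sheaf_def)

lemma hom_sheaf_category_point:
  "hom (sheaf_category (point_category a) (\<lambda>_. {{a}})) F G =
    {Mor F G \<tau> | \<tau>. nat_trans (point_category a) set_category F G \<tau>}"
  by (auto simp: sheaf_category_def hom_full_subcategory hom_functor_category is_sheaf_point
      dest: nat_transD(1,2))

text \<open>A functor on the one-arrow category is determined by its value on the object. Constant
  functors and evaluation at \<open>a\<close> are therefore strictly inverse, not merely
  pseudo-inverse.\<close>

lemma topos_set_category:
  assumes U: "universe TYPE('u)"
  shows "topos TYPE('u) (set_category :: ('u set, 'u setarr) category)"
proof -
  fix a :: 'u
  let ?C = "point_category a"
  let ?Set = "set_category :: ('u set, 'u setarr) category"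
  let ?Sh = "sheaf_category ?C (\<lambda>_. {{a}}) :: (('u, 'u, 'u set, 'u setarr) func,
    (('u, 'u, 'u set, 'u setarr) func, 'u \<Rightarrow> 'u setarr) mor) category"
  let ?const = "\<lambda>A :: 'u set. \<lparr>fobj = (\<lambda>_\<in>{a}. A), farr = (\<lambda>_\<in>{a}. Ident ?Set A)\<rparr>"
  let ?K = "\<lparr>fobj = (\<lambda>A\<in>Obj ?Set. ?const A),
    farr = (\<lambda>f\<in>Arr ?Set. Mor (?const (Dom ?Set f)) (?const (Cod ?Set f)) (\<lambda>_\<in>{a}. f))\<rparr>"
  let ?ev = "\<lparr>fobj = (\<lambda>F\<in>Obj ?Sh. fobj F a), farr = (\<lambda>\<alpha>\<in>Arr ?Sh. cmp \<alpha> a)\<rparr>"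
  note Set = is_category_set_category
  have Sh: "is_category ?Sh"
    unfolding sheaf_category_def
    by (intro is_category_full_subcategory is_category_functor_category)
      (simp_all add: is_category_point_category Set)
  have obj: "F \<in> Obj ?Sh \<longleftrightarrow> is_functor ?C ?Set F" for F :: "('u, 'u, 'u set, 'u setarr) func"
    by (auto simp: sheaf_category_def functor_category_def is_sheaf_point)
  have sh_ops: "Ident ?Sh F = Mor F F (\<lambda>_\<in>{a}. Ident ?Set (fobj F a))"
    "Comp ?Sh \<beta> \<alpha> = Mor (src \<alpha>) (tgt \<beta>) (\<lambda>_\<in>{a}. Comp ?Set (cmp \<beta> a) (cmp \<alpha> a))" for F \<alpha> \<beta>
    by (auto simp: sheaf_category_def functor_category_def restrict_def fun_eq_iff)
  have const: "is_functor ?C ?Set (?const A)" if "A \<in> Obj ?Set" for A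
    using that Set ident_hom[OF Set that] comp_ident[OF Set ident_hom[OF Set that]]
      is_category_point_category by (auto simp: is_functor_def hom_def)
  \<comment> \<open>The sole arrow is an identity, so \<open>F\<close> sends it to the identity of
    \<open>fobj F a\<close>, just as the constant functor does.\<close>
  have const_eq: "?const (fobj F a) = F" if F: "is_functor ?C ?Set F" for F
    by (rule func_eqI[OF const F])
      (use functor_obj[OF F] functor_ident[OF F, of a] in auto)
  have K: "is_functor ?Set ?Sh ?K"
  proof (rule is_functorI[OF Set Sh])
    fix f A B assume f: "f \<in> hom ?Set A B"
    note A = hom_objD(1)[OF Set f] and B = hom_objD(2)[OF Set f]
    have "nat_trans ?C ?Set (?const A) (?const B) (\<lambda>_\<in>{a}. f)"
      using const[OF A] const[OF B] f comp_ident[OF Set f] by (auto simp: nat_trans_def)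
    then show "farr ?K f \<in> hom ?Sh (fobj ?K A) (fobj ?K B)"
      unfolding hom_sheaf_category_point using A B hom_arrD[OF f] by simp
  next
    fix A assume A: "A \<in> Obj ?Set"
    then show "farr ?K (Ident ?Set A) = Ident ?Sh (fobj ?K A)"
      using hom_arrD[OF ident_hom[OF Set A]] by (simp add: sh_ops)
  next
    fix f g A B C assume f: "f \<in> hom ?Set A B" and g: "g \<in> hom ?Set B C"
    show "farr ?K (Comp ?Set g f) = Comp ?Sh (farr ?K g) (farr ?K f)"
      using hom_arrD[OF f] hom_arrD[OF g] hom_arrD[OF comp_hom[OF Set f g]] by (simp add: sh_ops)
  qed (auto simp: obj const)
  have ev: "is_functor ?Sh ?Set ?ev"
  proof (rule is_functorI[OF Sh Set])
    fix \<alpha> F G assume \<alpha>: "\<alpha> \<in> hom ?Sh F G"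
    then obtain \<tau> where "\<alpha> = Mor F G \<tau>" "nat_trans ?C ?Set F G \<tau>"
      unfolding hom_sheaf_category_point by blast
    then show "farr ?ev \<alpha> \<in> hom ?Set (fobj ?ev F) (fobj ?ev G)"
      using hom_objD[OF Sh \<alpha>] hom_arrD[OF \<alpha>] by (auto dest: nat_transD(4)[of _ _ _ _ _ a])
  next
    fix F assume F: "F \<in> Obj ?Sh"
    then show "farr ?ev (Ident ?Sh F) = Ident ?Set (fobj ?ev F)"
      using hom_arrD[OF ident_hom[OF Sh F]] by (simp add: sh_ops)
  next
    fix \<alpha> \<beta> F G H assume \<alpha>: "\<alpha> \<in> hom ?Sh F G" and \<beta>: "\<beta> \<in> hom ?Sh G H"
    show "farr ?ev (Comp ?Sh \<beta> \<alpha>) = Comp ?Set (farr ?ev \<beta>) (farr ?ev \<alpha>)"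
      using hom_arrD[OF \<alpha>] hom_arrD[OF \<beta>] hom_arrD[OF comp_hom[OF Sh \<alpha> \<beta>]] by (simp add: sh_ops)
  qed (auto simp: obj functor_obj)
  have equiv: "equivalence ?Set ?Sh ?K"
  proof (rule inverse_functors_equivalence[OF K ev])
    fix A assume "A \<in> Obj ?Set"
    then show "fobj ?ev (fobj ?K A) = A" using functor_obj[OF K, of A] by simp
  next
    fix f assume "f \<in> Arr ?Set"
    then show "farr ?ev (farr ?K f) = f" using functor_arr[OF K, of f] by simp
  next
    fix F assume F: "F \<in> Obj ?Sh"
    then show "fobj ?K (fobj ?ev F) = F"
      using functor_obj[OF ev F] const_eq obj by simp
  next
    fix \<alpha> assume \<alpha>: "\<alpha> \<in> Arr ?Sh"
    then obtain F G \<tau> where \<alpha>_eq: "\<alpha> = Mor F G \<tau>" and \<tau>: "nat_trans ?C ?Set F G \<tau>"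
      using arr_hom[OF \<alpha>] unfolding hom_sheaf_category_point by blast
    have "\<tau> a \<in> hom ?Set (fobj F a) (fobj G a)" using nat_transD(4)[OF \<tau>] by simp
    moreover have "(\<lambda>_\<in>{a}. \<tau> a) = \<tau>"
      using nat_transD(3)[OF \<tau>] by (auto simp: fun_eq_iff extensional_def)
    ultimately show "farr ?K (farr ?ev \<alpha>) = \<alpha>"
      using \<alpha> const_eq[OF nat_transD(1)[OF \<tau>]] const_eq[OF nat_transD(2)[OF \<tau>]]
      by (auto simp: \<alpha>_eq dest: hom_arrD)
  qed
  \<comment> \<open>The universe contains an infinite small set, hence is infinite, so that a
    singleton has strictly smaller cardinality and the site is small.\<close>
  have "infinite (UNIV :: 'u set)"
    using U unfolding universe_def by (metis finite_subset subset_UNIV)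
  then have "small {a}"
    unfolding small_def by (simp add: finite_lesspoll_infinite)
  then have small: "small_category ?C" by (simp add: small_category_def is_category_point_category)
  show ?thesis
    unfolding topos_def equivalent_def
    by (intro exI conjI) (rule small, rule grothendieck_topology_point, rule equiv)
qed

section \<open>The Scott topos of the models\<close>

theorem theorem3p1p8:
  fixes S :: "'u sketch"
    and T :: "('o, 'a) category"
    and \<epsilon> :: "(('u, 'o, 'a) scott_obj, ('u, 'o, 'a) scott_arr, 'o, 'a) geom"
  assumes "universe TYPE('u)"
    and "geometric_sketch S"
    and "classifying_topos S T"
    and "is_scott_counit TYPE('u) T \<epsilon>"
    and "geometric_equivalence (scott TYPE('u) (points TYPE('u) T)) T \<epsilon>"
  shows "equivalent T (scott TYPE('u) (set_models S))"
proof -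
  let ?pt = "points TYPE('u) T"
  \<comment> \<open>Over the test topos of sets, the generic points are by definition the points of
    \<open>T\<close>, and the models are \<open>set_models S\<close>.\<close>
  obtain \<Phi> where "equivalence ?pt (set_models S) \<Phi>"
    using assms(3) topos_set_category[OF assms(1)]
    unfolding classifying_topos_def points_def by blast
  then obtain \<Psi> where "equivalence (set_models S) ?pt \<Psi>"
    using equivalence_inverse by metis
  from equivalence_precompose[OF this is_category_set_category]
  have "equivalence (scott TYPE('u) ?pt) (scott TYPE('u) (set_models S))
      (precompose TYPE('u) (set_models S) ?pt set_category \<Psi>)"
    unfolding scott_def .
  \<comment> \<open>The inverse image runs against the geometric morphism, so it starts at
    \<open>T\<close> and composes directly with the precomposition functor.\<close>
  moreover have "equivalence T (scott TYPE('u) ?pt) (inv_image \<epsilon>)"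
    using assms(5) by (simp add: geometric_equivalence_def)
  ultimately show ?thesis
    unfolding equivalent_def using equivalence_trans by blast
qed

end
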